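(* Let $p$ be a prime, let $H$ be a finite group and let $G \subset \mathrm{PGL}_2(\mathbb{C}_p)$ be a finitely generated discontinuous group. Let $\Gamma$ be the kernel of a homomorphism $\varphi : G \to H$. Then the following statements are equivalent: (i) $\Gamma$ is a Schottky group; (ii) $\varphi|_{G_i}$ is injective for every vertex group $G_i$ in the quotient graph of groups $\mathcal{G}^*(G)$.
   Context: $\mathbb{C}_p$ is the completion of an algebraic closure of $\mathbb{Q}_p$. For a subgroup $G\subset \mathrm{PGL}_2(\mathbb{C}_p)$, a point $x\in\mathbb{P}^1(\mathbb{C}_p)$ is a limit point of $G$ if there are pairwise different $\gamma_n\in G$ ($n\in\mathbb{N}$) and a point $y\in\mathbb{P}^1(\mathbb{C}_p)$ with $\lim\gamma_n(y)=x$. Let $\mathcal{L}(G)$ be the set of limit points and $\Omega(G):=\mathbb{P}^1(\mathbb{C}_p)\setminus\mathcal{L}(G)$. $G$ is discontinuous if $\Omega(G)\neq\emptyset$ and for each $x\in \mathbb{P}^1(\mathbb{C}_p)$ the closure of the orbit $Gx$ is compact. A Schottky group is a finitely generated discontinuous group without non-trivial elements of finite order. Quotient graph $\mathcal{G}^*(G)$. Let $G\subset\mathrm{PGL}_2(\mathbb{C}_p)$ be finitely generated and discontinuous; its non-trivial elements are hyperbolic or elliptic, and each has a set $F(\gamma)$ of two fixed points in $\mathbb{P}^1(\mathbb{C}_p)$. Let $k\subset\mathbb{C}_p$ be the extension of $\mathbb{Q}_p$ generated by the coefficients of the generators of $G$ and the fixed points of representatives of the finitely many conjugacy classes of elliptic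 elements of $G$; the set of absolute values $|k^\times|$ is taken to be discrete in $\mathbb{R}^\times$. The Bruhat–Tits tree $\mathcal{B}(k)$ has as vertices the balls $B(x,r)=\{y\in k: |x-y|\le r\}$ with $x\in k$, $r\in|k^\times|$, and an edge joins $B(x,r)$ and $B(x',r')$ whenever $B(x,r)\subset B(x',r')$ and $[r,r']\cap|k^\times|=\{r,r'\}$, $r \neq r'$. Its ends correspond bijectively to the points of $\mathbb{P}^1(\hat k)$, $\hat k$ the completion of $k$. $\mathrm{PGL}_2(k)$ acts on $\mathcal{B}(k)$, and vertices are added (edges subdivided) so that the action is without inversion. Let $F(G)=\bigcup_{\gamma\in G\setminus\{1\}} F(\gamma)\subset\mathbb{P}^1(\hat k)$, and let $\mathcal{T}^*(G)$ be the subtree of $\mathcal{B}(k)$ generated by the ends corresponding to $F(G)$ (the union of the infinite paths joining two such ends). $G$ acts on $\mathcal{T}^*(G)$ and $\mathcal{G}^*(G):=\mathcal{T}^*(G)/G$ is the quotient graph, made into a graph of groups by labelling the image of each vertex or edge $x$ with (the conjugacy class of) its stabilizer $G_x$. The vertex groups of $\mathcal{G}^*(G)$ are thus the stabilizers in $G$ of vertices of $\mathcal{T}^*(G)$. *)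

theory Defs
  imports
    "HOL-Analysis.Analysis"
    "HOL-Algebra.Algebraic_Closure_Type"
    "HOL-Algebra.Generated_Groups"
    "HOL-Algebra.Generated_Fields"
    "HOL-Algebra.Group_Action"
    "Graph_Theory.Pair_Digraph"
begin

no_notation eq_closure_of (\<open>closure'_of\<index>\<close>)

section \<open>The field of $p$-adic complex numbers\<close>

text \<open>
  Fields of characteristic $0$ that are complete with respect to a multiplicative ultrametric
  absolute value. The constant \<^const>\<open>norm\<close> cannot be used for the absolute value, since it is
  restricted to real normed vector spaces.
\<close>
class complete_valued_field = field_char_0 + complete_space +
  fixes vabs :: "'a \<Rightarrow> real"
  assumes dist_vabs: "dist x y = vabs (x - y)"
    and vabs_mult: "vabs (x * y) = vabs x * vabs y"
    and vabs_add_le_max: "vabs (x + y) \<le> max (vabs x) (vabs y)"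

text \<open>
  The closure of the rationals in a complete field; it is the completion of the rationals with
  respect to the absolute value \<^const>\<open>vabs\<close>. When \<open>vabs p < 1\<close> for a prime \<open>p\<close>, this absolute
  value is \<open>p\<close>-adic on the rationals, and the closure is the field of \<open>p\<close>-adic numbers.
\<close>
definition Qp :: "'a::complete_valued_field set" where
  "Qp = closure \<rat>"

text \<open>
  The type \<open>'a\<close> is a completion of an algebraic closure \<open>A\<close> of the field of \<open>p\<close>-adic numbers,
  with the usual normalization of the absolute value. This determines \<open>'a\<close> up to isometric
  isomorphism; statements about $\mathbb{C}_p$ are made for every such type.
\<close>
definition is_Cp :: "nat \<Rightarrow> 'a::complete_valued_field itself \<Rightarrow> bool" where
  "is_Cp p T \<longleftrightarrow> vabs (of_nat p :: 'a) = 1 / of_nat p \<and>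
     (\<exists>A :: 'a set. algebraic_closure (ring_of_type_algebra\<lparr>carrier := A\<rparr>) Qp \<and> closure A = UNIV)"


section \<open>The projective line and its automorphism group\<close>

definition proj_point :: "'a::field^2 \<Rightarrow> ('a^2) set" where
  "proj_point v = range (\<lambda>c. c *s v)"

definition P1 :: "('a::field^2) set set" where
  "P1 = proj_point ` (- {0})"

text \<open>The quotient topology with respect to \<^const>\<open>proj_point\<close>, see \<open>openin_P1\<close>.\<close>
definition P1_topology :: "('a::complete_valued_field^2) set topology" where
  "P1_topology = topology (\<lambda>U. U \<subseteq> P1 \<and> open {v. v \<noteq> 0 \<and> proj_point v \<in> U})"

lemma openin_P1:
  "openin P1_topology U \<longleftrightarrow> U \<subseteq> P1 \<and> open {v. v \<noteq> 0 \<and> proj_point v \<in> U}"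
proof -
  have "istopology (\<lambda>U. U \<subseteq> P1 \<and> open {v::'a^2. v \<noteq> 0 \<and> proj_point v \<in> U})"
    unfolding istopology_def
  proof (intro conjI allI impI)
    fix S T :: "('a^2) set set"
    assume S: "S \<subseteq> P1 \<and> open {v. v \<noteq> 0 \<and> proj_point v \<in> S}"
      and T: "T \<subseteq> P1 \<and> open {v. v \<noteq> 0 \<and> proj_point v \<in> T}"
    show "S \<inter> T \<subseteq> P1" using S by blast
    have "{v. v \<noteq> 0 \<and> proj_point v \<in> S \<inter> T}
        = {v. v \<noteq> 0 \<and> proj_point v \<in> S} \<inter> {v. v \<noteq> 0 \<and> proj_point v \<in> T}" by blast
    then show "open {v. v \<noteq> 0 \<and> proj_point v \<in> S \<inter> T}" using S T by auto
  next
    fix \<K> :: "('a^2) set set set"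
    assume K: "\<forall>U\<in>\<K>. U \<subseteq> P1 \<and> open {v. v \<noteq> 0 \<and> proj_point v \<in> U}"
    show "\<Union>\<K> \<subseteq> P1" using K by blast
    have "{v. v \<noteq> 0 \<and> proj_point v \<in> \<Union>\<K>} = (\<Union>U\<in>\<K>. {v. v \<noteq> 0 \<and> proj_point v \<in> U})"
      by blast
    then show "open {v. v \<noteq> 0 \<and> proj_point v \<in> \<Union>\<K>}" using K by auto
  qed
  then show ?thesis by (simp add: P1_topology_def topology_inverse')
qed

text \<open>
  In the affine coordinate \<open>z = v $ 1 / v $ 2\<close>, a matrix acts on the projective line by
  $z \mapsto (az+b)/(cz+d)$, and \<open>\<infinity>\<close> is the point with no affine coordinate.
\<close>
definition affine_coords :: "('a::field^2) set \<Rightarrow> 'a set" where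
  "affine_coords x = {v $ 1 / v $ 2 | v. v \<in> x \<and> v $ 2 \<noteq> 0}"

definition GL2 :: "('a::field^2^2) monoid" where
  "GL2 = \<lparr>carrier = {A. invertible A}, monoid.mult = (**), one = mat 1\<rparr>"

definition scalars :: "('a::field^2^2) set" where
  "scalars = {mat c | c. c \<noteq> 0}"

text \<open>Elements of \<open>PGL2\<close> are cosets, that is, sets of matrices.\<close>
definition PGL2 :: "('a::field^2^2) set monoid" where
  "PGL2 = GL2 Mod scalars"

lemma group_GL2: "group (GL2 :: ('a::field^2^2) monoid)"
proof (rule groupI)
  fix A :: "'a^2^2" assume "A \<in> carrier GL2"
  then obtain B where "A ** B = mat 1" "B ** A = mat 1"
    by (auto simp: GL2_def invertible_def)
  then show "\<exists>B\<in>carrier GL2. B \<otimes>\<^bsub>GL2\<^esub> A = \<one>\<^bsub>GL2\<^esub>"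
    by (auto simp: GL2_def invertible_def)
qed (auto simp: GL2_def invertible_mult matrix_mul_assoc invertible_def[of "mat 1"])

lemma mat_mult_left: "mat c ** A = (\<chi> i j. c * A $ i $ j)"
  for A :: "'a::field^2^2"
  by (auto simp: vec_eq_iff matrix_matrix_mult_def mat_def sum_2 forall_2)

lemma mat_mult_right: "A ** mat c = (\<chi> i j. c * A $ i $ j)"
  for A :: "'a::field^2^2"
  by (auto simp: vec_eq_iff matrix_matrix_mult_def mat_def sum_2 forall_2)

lemma mat_mult_mat: "mat a ** mat b = (mat (a * b) :: 'a::field^2^2)"
  by (simp add: mat_mult_left) (auto simp: mat_def vec_eq_iff)

lemma mat_in_GL2: "c \<noteq> 0 \<Longrightarrow> mat c \<in> carrier (GL2 :: ('a::field^2^2) monoid)"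
  unfolding GL2_def invertible_def
  by (auto intro!: exI[of _ "mat (inverse c)"] simp: mat_mult_mat)

lemma normal_scalars: "scalars \<lhd> (GL2 :: ('a::field^2^2) monoid)"
proof -
  interpret group "GL2 :: ('a^2^2) monoid" by (rule group_GL2)
  have inv: "inv\<^bsub>GL2\<^esub> (mat c :: 'a^2^2) = mat (inverse c)" if "c \<noteq> 0" for c
    by (rule inv_equality) (use that in \<open>auto simp: mat_in_GL2\<close>, simp add: GL2_def mat_mult_mat)
  have "subgroup scalars (GL2 :: ('a^2^2) monoid)"
  proof
    show "scalars \<subseteq> carrier (GL2 :: ('a^2^2) monoid)"
      by (auto simp: scalars_def mat_in_GL2)
    fix x y :: "'a^2^2" assume "x \<in> scalars" "y \<in> scalars"
    then show "x \<otimes>\<^bsub>GL2\<^esub> y \<in> scalars"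
      by (auto simp: scalars_def GL2_def mat_mult_mat)
  next
    show "\<one>\<^bsub>GL2\<^esub> \<in> (scalars :: ('a^2^2) set)"
      by (auto simp: scalars_def GL2_def)
  next
    fix x :: "'a^2^2" assume "x \<in> scalars"
    then show "inv\<^bsub>GL2\<^esub> x \<in> scalars"
      by (auto simp: scalars_def inv)
  qed
  moreover have "x \<otimes>\<^bsub>GL2\<^esub> h \<otimes>\<^bsub>GL2\<^esub> inv\<^bsub>GL2\<^esub> x \<in> scalars"
    if "x \<in> carrier GL2" "h \<in> scalars" for x h :: "'a^2^2"
  proof -
    from that(2) obtain c where c: "h = mat c" "c \<noteq> 0" unfolding scalars_def by blast
    have "x \<otimes>\<^bsub>GL2\<^esub> h = h \<otimes>\<^bsub>GL2\<^esub> x"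
      by (simp add: GL2_def c mat_mult_left mat_mult_right)
    then have "x \<otimes>\<^bsub>GL2\<^esub> h \<otimes>\<^bsub>GL2\<^esub> inv\<^bsub>GL2\<^esub> x = h"
      using that c by (simp add: m_assoc mat_in_GL2)
    then show ?thesis using that by simp
  qed
  ultimately show ?thesis by (simp add: normal_inv_iff)
qed

lemma group_PGL2: "group (PGL2 :: ('a::field^2^2) set monoid)"
  unfolding PGL2_def by (rule normal.factorgroup_is_group[OF normal_scalars])

definition PGL2_class :: "'a::field^2^2 \<Rightarrow> ('a^2^2) set" where
  "PGL2_class A = scalars #>\<^bsub>GL2\<^esub> A"

definition P1_act :: "('a::field^2^2) set \<Rightarrow> ('a^2) set \<Rightarrow> ('a^2) set" where
  "P1_act \<gamma> x = (\<Union>A\<in>\<gamma>. (*v) A ` x)"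

definition fixed_points :: "('a::field^2^2) set \<Rightarrow> ('a^2) set set" where
  "fixed_points \<gamma> = {x \<in> P1. P1_act \<gamma> x = x}"

text \<open>Two different eigenvalues of the same absolute value.\<close>
definition elliptic :: "('a::complete_valued_field^2^2) set \<Rightarrow> bool" where
  "elliptic \<gamma> \<longleftrightarrow> (\<exists>A\<in>\<gamma>. \<exists>a b v w. a \<noteq> b \<and> vabs a = vabs b \<and>
     v \<noteq> 0 \<and> A *v v = a *s v \<and> w \<noteq> 0 \<and> A *v w = b *s w)"


section \<open>Discontinuous groups and Schottky groups\<close>

definition limit_points :: "('a::complete_valued_field^2^2) set set \<Rightarrow> ('a^2) set set" where
  "limit_points G = {x \<in> P1. \<exists>\<gamma> y. inj \<gamma> \<and> range \<gamma> \<subseteq> G \<and> y \<in> P1 \<and>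
     limitin P1_topology (\<lambda>n::nat. P1_act (\<gamma> n) y) x sequentially}"

definition ordinary_points :: "('a::complete_valued_field^2^2) set set \<Rightarrow> ('a^2) set set" where
  "ordinary_points G = P1 - limit_points G"

definition discontinuous :: "('a::complete_valued_field^2^2) set set \<Rightarrow> bool" where
  "discontinuous G \<longleftrightarrow> subgroup G PGL2 \<and> ordinary_points G \<noteq> {} \<and>
     (\<forall>x\<in>P1. compactin P1_topology (P1_topology closure_of {P1_act \<gamma> x | \<gamma>. \<gamma> \<in> G}))"

definition finitely_generated :: "('g, 'm) monoid_scheme \<Rightarrow> 'g set \<Rightarrow> bool" where
  "finitely_generated \<G> G \<longleftrightarrow> (\<exists>S. finite S \<and> S \<subseteq> carrier \<G> \<and> generate \<G> S = G)"

definition schottky :: "('a::complete_valued_field^2^2) set set \<Rightarrow> bool" where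
  "schottky G \<longleftrightarrow> finitely_generated PGL2 G \<and> discontinuous G \<and>
     (\<forall>\<gamma>\<in>G. \<gamma> \<noteq> \<one>\<^bsub>PGL2\<^esub> \<longrightarrow> (\<forall>n>0. \<gamma> [^]\<^bsub>PGL2\<^esub> (n::nat) \<noteq> \<one>\<^bsub>PGL2\<^esub>))"


section \<open>The coefficient field of a group\<close>

text \<open>\<open>E\<close> contains exactly one element of each conjugacy class of elliptic elements of \<open>G\<close>.\<close>
definition elliptic_representatives ::
    "('a::complete_valued_field^2^2) set set \<Rightarrow> ('a^2^2) set set \<Rightarrow> bool" where
  "elliptic_representatives G E \<longleftrightarrow> E \<subseteq> {\<gamma>\<in>G. elliptic \<gamma>} \<and>
     (\<forall>\<gamma>\<in>G. elliptic \<gamma> \<longrightarrow>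
        (\<exists>!\<epsilon>. \<epsilon> \<in> E \<and> (\<exists>\<delta>\<in>G. \<gamma> = \<delta> \<otimes>\<^bsub>PGL2\<^esub> \<epsilon> \<otimes>\<^bsub>PGL2\<^esub> inv\<^bsub>PGL2\<^esub> \<delta>)))"

text \<open>
  \<open>k\<close> arises from some choice of matrices \<open>M\<close> that represent finitely many generators of \<open>G\<close>
  and some choice of representatives \<open>E\<close> of the conjugacy classes of elliptic elements.
\<close>
definition coefficient_field ::
    "('a::complete_valued_field^2^2) set set \<Rightarrow> 'a set \<Rightarrow> bool" where
  "coefficient_field G k \<longleftrightarrow> (\<exists>M E.
     finite M \<and> M \<subseteq> carrier GL2 \<and> generate PGL2 (PGL2_class ` M) = G \<and>
     elliptic_representatives G E \<and>
     k = generate_field ring_of_type_algebra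
           (Qp \<union> {A $ i $ j | A i j. A \<in> M} \<union>
            (\<Union>\<epsilon>\<in>E. \<Union>x\<in>fixed_points \<epsilon>. affine_coords x)))"

definition value_group :: "'a::complete_valued_field set \<Rightarrow> real set" where
  "value_group k = vabs ` (k - {0})"


section \<open>The Bruhat--Tits tree\<close>

definition kball :: "'a::complete_valued_field set \<Rightarrow> 'a \<Rightarrow> real \<Rightarrow> 'a set" where
  "kball k x r = {y \<in> k. vabs (x - y) \<le> r}"

definition bt_tree :: "'a::complete_valued_field set \<Rightarrow> 'a set pair_pre_digraph" where
  "bt_tree k = \<lparr>
     pverts = {kball k x r | x r. x \<in> k \<and> r \<in> value_group k},
     parcs = symcl {(kball k x r, kball k x' r') | x r x' r'.
       x \<in> k \<and> x' \<in> k \<and> r \<in> value_group k \<and> r' \<in> value_group k \<and>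
       kball k x r \<subseteq> kball k x' r' \<and> {r..r'} \<inter> value_group k = {r, r'} \<and> r \<noteq> r'}\<rparr>"

text \<open>
  The ball \<open>kball k x (vabs a)\<close>, with \<open>x\<close> and \<open>a \<noteq> 0\<close> in \<open>k\<close>, stands for the homothety class of
  the lattice in \<open>k\<^sup>2\<close> that is spanned by $(a, 0)$ and $(x, 1)$ over the valuation ring of \<open>k\<close>.
  The group $\mathrm{PGL}_2(k)$ acts on these classes. A matrix in \<open>\<gamma>\<close> that maps one such lattice
  to another one automatically has entries in \<open>k\<close>.
\<close>
definition ball_lattice :: "'a::complete_valued_field set \<Rightarrow> 'a \<Rightarrow> real \<Rightarrow> ('a^2) set" where
  "ball_lattice k x r =
     {v. v $ 1 \<in> k \<and> v $ 2 \<in> k \<and> vabs (v $ 2) \<le> 1 \<and> vabs (v $ 1 - v $ 2 * x) \<le> r}"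

definition bt_act ::
    "'a::complete_valued_field set \<Rightarrow> ('a^2^2) set \<Rightarrow> 'a set \<Rightarrow> 'a set" where
  "bt_act k \<gamma> B = (THE B'. \<exists>x r x' r'. x \<in> k \<and> r \<in> value_group k \<and> B = kball k x r \<and>
     x' \<in> k \<and> r' \<in> value_group k \<and> B' = kball k x' r' \<and>
     (\<exists>A\<in>\<gamma>. (*v) A ` ball_lattice k x r = ball_lattice k x' r'))"

text \<open>
  The path \<open>w\<close> in the tree leads to the end that corresponds to the point \<open>x\<close> of the projective
  line: the balls shrink to \<open>x\<close> if \<open>x\<close> is finite, and exhaust \<open>k\<close> if \<open>x\<close> is infinity.
\<close>
definition leads_to ::
    "'a::complete_valued_field set \<Rightarrow> (nat \<Rightarrow> 'a set) \<Rightarrow> ('a^2) set \<Rightarrow> bool" where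
  "leads_to k w x \<longleftrightarrow>
     (if affine_coords x = {} then \<forall>R. \<forall>\<^sub>F n in sequentially. kball k 0 R \<subseteq> w n
      else \<forall>z\<in>affine_coords x. \<forall>e>0. \<forall>\<^sub>F n in sequentially. w n \<subseteq> cball z e)"

text \<open>The infinite paths without backtracking that join the ends \<open>x\<close> and \<open>y\<close>.\<close>
definition joining_path ::
    "'a::complete_valued_field set \<Rightarrow> (int \<Rightarrow> 'a set) \<Rightarrow> ('a^2) set \<Rightarrow> ('a^2) set \<Rightarrow> bool" where
  "joining_path k w x y \<longleftrightarrow> inj w \<and> (\<forall>i. (w i, w (i + 1)) \<in> parcs (bt_tree k)) \<and>
     leads_to k (\<lambda>n. w (- int n)) x \<and> leads_to k (\<lambda>n. w (int n)) y"

definition all_fixed_points :: "('a::complete_valued_field^2^2) set set \<Rightarrow> ('a^2) set set" where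
  "all_fixed_points G = (\<Union>\<gamma>\<in>G - {\<one>\<^bsub>PGL2\<^esub>}. fixed_points \<gamma>)"

text \<open>The subtree of \<^const>\<open>bt_tree\<close> generated by the ends in \<^const>\<open>all_fixed_points\<close>.\<close>
definition fixed_point_subtree ::
    "'a::complete_valued_field set \<Rightarrow> ('a^2^2) set set \<Rightarrow> 'a set pair_pre_digraph" where
  "fixed_point_subtree k G = (let W = {w. \<exists>x\<in>all_fixed_points G. \<exists>y\<in>all_fixed_points G.
       joining_path k w x y} in
     \<lparr>pverts = {w i | w i. w \<in> W}, parcs = symcl {(w i, w (i + 1)) | w i. w \<in> W}\<rparr>)"

text \<open>
  Every edge of the tree is inverted by some element of $\mathrm{PGL}_2(k)$, hence every edge is
  subdivided. A vertex \<open>B\<close> of the original graph becomes \<open>{B}\<close>, and the new vertex in the middle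
  of the edge between \<open>B\<close> and \<open>B'\<close> is \<open>{B, B'}\<close>.
\<close>
definition subdivision :: "'b pair_pre_digraph \<Rightarrow> 'b set pair_pre_digraph" where
  "subdivision T = \<lparr>
     pverts = {{B} | B. B \<in> pverts T} \<union> {{B, B'} | B B'. (B, B') \<in> parcs T},
     parcs = symcl {({B}, {B, B'}) | B B'. (B, B') \<in> parcs T}\<rparr>"

definition reduced_tree ::
    "'a::complete_valued_field set \<Rightarrow> ('a^2^2) set set \<Rightarrow> 'a set set pair_pre_digraph" where
  "reduced_tree k G = subdivision (fixed_point_subtree k G)"


section \<open>The quotient graph of groups\<close>

text \<open>The labels are conjugacy classes of subgroups.\<close>
record ('v, 'e, 'g) graph_of_groups = "('v, 'e) pre_digraph" +
  vert_label :: "'v \<Rightarrow> 'g set set"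
  arc_label :: "'e \<Rightarrow> 'g set set"

text \<open>
  The quotient of \<open>T\<close> by an action without inversion of \<open>\<G>\<close>. Vertices and arcs of the quotient
  are orbits; the stabilizers of the elements of an orbit form a conjugacy class.
\<close>
definition quotient_graph ::
    "('g, 'm) monoid_scheme \<Rightarrow> ('g \<Rightarrow> 'v \<Rightarrow> 'v) \<Rightarrow> 'v pair_pre_digraph \<Rightarrow>
     ('v set, ('v \<times> 'v) set, 'g) graph_of_groups" where
  "quotient_graph \<G> act T = \<lparr>
     verts = orbits \<G> (pverts T) act,
     arcs = orbits \<G> (parcs T) (\<lambda>g. map_prod (act g) (act g)),
     tail = (\<lambda>e. fst ` e),
     head = (\<lambda>e. snd ` e),
     vert_label = (\<lambda>v. stabilizer \<G> act ` v),
     arc_label = (\<lambda>e. stabilizer \<G> (\<lambda>g. map_prod (act g) (act g)) ` e)\<rparr>"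

definition vertex_groups :: "('v, 'e, 'g) graph_of_groups \<Rightarrow> 'g set set" where
  "vertex_groups Q = (\<Union>v\<in>verts Q. vert_label Q v)"

definition reduced_quotient_graph ::
    "'a::complete_valued_field set \<Rightarrow> ('a^2^2) set set \<Rightarrow>
     ('a set set set, ('a set set \<times> 'a set set) set, ('a^2^2) set) graph_of_groups" where
  "reduced_quotient_graph k G =
     quotient_graph (PGL2\<lparr>carrier := G\<rparr>) (\<lambda>\<gamma>. (`) (bt_act k \<gamma>)) (reduced_tree k G)"

end

theory Submission
  imports Defs
begin

text \<open>
  A group element \<open>\<gamma>\<close> that fixes a vertex of the tree acts by isometries of the gauge of the
  corresponding lattice. If \<open>\<gamma>\<close> had infinite order, compactness of the orbit closures would make every
  point \<open>y\<close> a limit of some $\gamma^{n_j} y$, so there would be no ordinary point. Thus vertex groups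
  are torsion groups, and a torsion-free kernel meets them trivially.

  Conversely, an element \<open>\<gamma> \<noteq> 1\<close> of finite order is diagonalizable with eigenvalues of the same
  absolute value, hence it fixes all vertices on the path between its two fixed points. These vertices
  belong to the subtree, so a homomorphism that is injective on the vertex groups cannot kill \<open>\<gamma>\<close>.
  Discontinuity passes to subgroups, and finite generation passes to subgroups of finite index.
\<close>

(* Otherwise the parse trees of vector components multiply. *)
no_notation fps_nth (infixl \<open>$\<close> 75)

section \<open>Kernels of homomorphisms to finite groups\<close>

text \<open>Points of the projective line have coordinates in all of \<open>'a\<close>, whereas the
  tree only sees \<open>k\<close>. The link is a norm: a basis of a lattice over the valuation ring
  of \<open>k\<close> is orthonormal for an ultrametric norm on the whole plane, so a matrix that
  preserves the lattice preserves the norm of every vector. As C_p is not locally compact, the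
  recurrence has to take place in the closure of a single orbit.

  For the converse, one vertex between the two fixed points is enough: the ball whose lattice is
  spanned by two normalized eigenvectors. After division by one eigenvalue, \<open>\<gamma>\<close>
  multiplies these basis vectors by units. The ball belongs to the subtree for two reasons. The
  fixed points are rational over \<open>k\<close>, since those of the representatives are adjoined
  and the conjugating elements have matrices over \<open>k\<close>. And the value group is infinite
  cyclic, because it is discrete and contains 1/p, so that the path between the two ends can be
  written down with radii q^i.\<close>

text \<open>Schreier's lemma: the generators are $t(h)\, g\, t(h \varphi(g))^{-1}$ for a section \<open>t\<close> of \<open>\<phi>\<close>.\<close>

lemma finitely_generated_kernel:
  fixes \<G> :: "('g, 'n) monoid_scheme" and H :: "('h, 'm) monoid_scheme"
  assumes "group \<G>" "subgroup G \<G>" "finitely_generated \<G> G"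
    and "group H" "finite (carrier H)" "\<phi> \<in> hom (\<G>\<lparr>carrier := G\<rparr>) H"
  shows "finitely_generated \<G> (kernel (\<G>\<lparr>carrier := G\<rparr>) H \<phi>)"
proof -
  interpret \<G>: Group.group \<G> by fact
  interpret G: subgroup G \<G> by fact
  interpret H: Group.group H by fact
  interpret \<phi>: group_hom "\<G>\<lparr>carrier := G\<rparr>" H \<phi>
    by (intro group_hom.intro group_hom_axioms.intro \<G>.subgroup_imp_group assms)
  from assms(3) obtain S where S: "finite S" "S \<subseteq> carrier \<G>" "generate \<G> S = G"
    unfolding finitely_generated_def by blast
  have SG: "S \<subseteq> G" using S(3) generate.incl by fast
  have m: "\<phi> (x \<otimes>\<^bsub>\<G>\<^esub> y) = \<phi> x \<otimes>\<^bsub>H\<^esub> \<phi> y" if "x \<in> G" "y \<in> G" for x y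
    using \<phi>.hom_mult[of x y] that by simp
  have c: "\<phi> x \<in> carrier H" if "x \<in> G" for x
    using \<phi>.hom_closed[of x] that by simp
  have hom1: "\<phi> \<one>\<^bsub>\<G>\<^esub> = \<one>\<^bsub>H\<^esub>" using \<phi>.hom_one by simp
  have i: "\<phi> (inv\<^bsub>\<G>\<^esub> x) = inv\<^bsub>H\<^esub> (\<phi> x)" if "x \<in> G" for x
    using \<phi>.hom_inv[of x] that \<G>.m_inv_consistent[OF assms(2) that] by simp
  \<comment> \<open>The section is normalized at the identity so that \<open>s \<one> g = g\<close>
    for \<open>g\<close> in the kernel. Its other values matter only on the image of
    \<open>\<phi>\<close>.\<close>
  define t where "t h = (if h = \<one>\<^bsub>H\<^esub> then \<one>\<^bsub>\<G>\<^esub> else SOME g. g \<in> G \<and> \<phi> g = h)" for h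
  have t: "t h \<in> G \<and> \<phi> (t h) = h" if "h \<in> \<phi> ` G" for h
  proof (cases "h = \<one>\<^bsub>H\<^esub>")
    case False
    have "\<exists>g. g \<in> G \<and> \<phi> g = h" using that by auto
    from someI_ex[OF this] False show ?thesis by (simp add: t_def)
  qed (simp add: t_def hom1)
  have img: "h \<otimes>\<^bsub>H\<^esub> \<phi> g \<in> \<phi> ` G" if "h \<in> \<phi> ` G" "g \<in> G" for h g
  proof -
    obtain x where "x \<in> G" "h = \<phi> x" using \<open>h \<in> \<phi> ` G\<close> by blast
    then have "h \<otimes>\<^bsub>H\<^esub> \<phi> g = \<phi> (x \<otimes>\<^bsub>\<G>\<^esub> g)" using m that by simp
    then show ?thesis using G.m_closed[OF \<open>x \<in> G\<close> that(2)] by (rule image_eqI)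
  qed
  define s where "s h g = t h \<otimes>\<^bsub>\<G>\<^esub> g \<otimes>\<^bsub>\<G>\<^esub> inv\<^bsub>\<G>\<^esub> (t (h \<otimes>\<^bsub>H\<^esub> \<phi> g))" for h g
  \<comment> \<open>The inverses of the generators are included so that \<open>s h (inv g)\<close>
    is itself a member of \<open>D\<close>; the induction over \<open>generate\<close> has a
    separate case for them.\<close>
  define D where "D = case_prod s ` (\<phi> ` G \<times> (S \<union> m_inv \<G> ` S))"
  let ?\<Gamma> = "kernel (\<G>\<lparr>carrier := G\<rparr>) H \<phi>"
  have \<Gamma>: "?\<Gamma> = {g \<in> G. \<phi> g = \<one>\<^bsub>H\<^esub>}" by (simp add: kernel_def)
  have sK: "s h g \<in> ?\<Gamma>" if "h \<in> \<phi> ` G" "g \<in> G" for h g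
  proof -
    have 1: "t h \<in> G" "\<phi> (t h) = h" "t (h \<otimes>\<^bsub>H\<^esub> \<phi> g) \<in> G" "\<phi> (t (h \<otimes>\<^bsub>H\<^esub> \<phi> g)) = h \<otimes>\<^bsub>H\<^esub> \<phi> g"
      using t[OF that(1)] t[OF img[OF that]] by auto
    have "h \<in> carrier H" using c[OF 1(1)] 1(2) by simp
    moreover have "\<phi> (s h g) = h \<otimes>\<^bsub>H\<^esub> \<phi> g \<otimes>\<^bsub>H\<^esub> inv\<^bsub>H\<^esub> (h \<otimes>\<^bsub>H\<^esub> \<phi> g)"
      unfolding s_def using 1 that by (simp add: m i)
    ultimately have "\<phi> (s h g) = \<one>\<^bsub>H\<^esub>" using c[OF that(2)] by simp
    then show ?thesis using that 1 unfolding \<Gamma> by (simp add: s_def)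
  qed
  have "finite (\<phi> ` G)" by (rule finite_subset[OF _ assms(5)]) (use c in auto)
  then have fin: "finite D" unfolding D_def using S(1) by blast
  have D\<Gamma>: "D \<subseteq> ?\<Gamma>"
    proof
    fix x assume "x \<in> D"
    then obtain h g where x: "x = s h g" "h \<in> \<phi> ` G" "g \<in> S \<union> m_inv \<G> ` S"
      unfolding D_def by auto
    then have "g \<in> G" using SG by blast
    then show "x \<in> ?\<Gamma>" using sK x by blast
  qed
  have \<Gamma>c: "subgroup ?\<Gamma> \<G>"
    by (rule \<G>.incl_subgroup[OF assms(2) \<phi>.subgroup_kernel])
  have Dc: "D \<subseteq> carrier \<G>" using D\<Gamma> \<Gamma> G.subset by blast
  \<comment> \<open>The claim is made for all \<open>h\<close> at once because a product shifts the
    coset: \<open>s h (x y) = s h x s (h \<phi>(x)) y\<close>, where the two inner values of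
    \<open>t\<close> cancel.\<close>
  have sD: "\<forall>h\<in>\<phi> ` G. s h g \<in> generate \<G> D" if "g \<in> G" for g
    using that[folded S(3)]
  proof (induction g rule: generate.induct)
    case one
    show ?case
    proof
      fix h assume "h \<in> \<phi> ` G"
      from t[OF this] have "t h \<in> G" "h \<in> carrier H" using c[of "t h"] by auto
      then have "s h \<one>\<^bsub>\<G>\<^esub> = \<one>\<^bsub>\<G>\<^esub>" by (simp add: s_def hom1)
      then show "s h \<one>\<^bsub>\<G>\<^esub> \<in> generate \<G> D" by (simp add: generate.one)
    qed
  next
    case (incl g)
    then show ?case by (intro ballI generate.incl) (force simp: D_def)
  next
    case (inv g)
    then show ?case by (intro ballI generate.incl) (force simp: D_def)
  next
    case (eng x y)
    have xy: "x \<in> G" "y \<in> G" using eng S(3) by auto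
    show ?case
    proof
      fix h assume h: "h \<in> \<phi> ` G"
      have 1: "t h \<in> G" "t (h \<otimes>\<^bsub>H\<^esub> \<phi> x) \<in> G" "t (h \<otimes>\<^bsub>H\<^esub> \<phi> x \<otimes>\<^bsub>H\<^esub> \<phi> y) \<in> G" "h \<in> carrier H"
        using t[OF h] t[OF img[OF h xy(1)]] t[OF img[OF img[OF h xy(1)] xy(2)]] c[of "t h"] by auto
      have "s h (x \<otimes>\<^bsub>\<G>\<^esub> y) = s h x \<otimes>\<^bsub>\<G>\<^esub> s (h \<otimes>\<^bsub>H\<^esub> \<phi> x) y"
      proof -
        have *: "inv\<^bsub>\<G>\<^esub> a \<otimes>\<^bsub>\<G>\<^esub> (a \<otimes>\<^bsub>\<G>\<^esub> b) = b" if "a \<in> carrier \<G>" "b \<in> carrier \<G>" for a b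
          using that by (simp flip: \<G>.m_assoc)
        have "h \<otimes>\<^bsub>H\<^esub> \<phi> (x \<otimes>\<^bsub>\<G>\<^esub> y) = h \<otimes>\<^bsub>H\<^esub> \<phi> x \<otimes>\<^bsub>H\<^esub> \<phi> y"
          using 1 xy by (simp add: m c H.m_assoc)
        then show ?thesis using 1 xy by (simp add: s_def \<G>.m_assoc *)
      qed
      then show "s h (x \<otimes>\<^bsub>\<G>\<^esub> y) \<in> generate \<G> D"
        using generate.eng[OF eng.IH(1)[rule_format, OF h] eng.IH(2)[rule_format, OF img[OF h xy(1)]]] by simp
    qed
  qed
  have "?\<Gamma> \<subseteq> generate \<G> D"
  proof
    fix g assume "g \<in> ?\<Gamma>"
    then have g: "g \<in> G" "\<phi> g = \<one>\<^bsub>H\<^esub>" by (auto simp: \<Gamma>)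
    have "\<one>\<^bsub>H\<^esub> \<in> \<phi> ` G" using image_eqI[of "\<one>\<^bsub>H\<^esub>" \<phi> "\<one>\<^bsub>\<G>\<^esub>" G] hom1 G.one_closed by simp
    then have "s \<one>\<^bsub>H\<^esub> g \<in> generate \<G> D" using sD g by blast
    moreover have "s \<one>\<^bsub>H\<^esub> g = g" using g by (simp add: s_def t_def)
    ultimately show "g \<in> generate \<G> D" by simp
  qed
  moreover have "generate \<G> D \<subseteq> ?\<Gamma>"
    using \<G>.generate_subgroup_incl[OF D\<Gamma> \<Gamma>c] .
  ultimately show ?thesis using fin Dc unfolding finitely_generated_def by blast
qed

section \<open>Ultrametric absolute values\<close>

lemma vabs_eq_0_iff [simp]: "vabs x = 0 \<longleftrightarrow> x = 0"
  using dist_vabs[of x 0] dist_eq_0_iff[of x 0] by simp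

lemma vabs_0 [simp]: "vabs 0 = 0" by simp

lemma vabs_nonneg [simp]: "vabs x \<ge> 0"
  using dist_vabs[of x 0] by (metis diff_zero zero_le_dist)

lemma vabs_pos_iff [simp]: "vabs x > 0 \<longleftrightarrow> x \<noteq> 0"
  using vabs_nonneg[of x] vabs_eq_0_iff[of x] by linarith

lemma vabs_le_0_iff [simp]: "vabs x \<le> 0 \<longleftrightarrow> x = 0"
  using vabs_nonneg[of x] vabs_eq_0_iff[of x] by linarith

lemma vabs_1 [simp]: "vabs 1 = 1"
  using vabs_mult[of 1 1] vabs_eq_0_iff[of 1] by simp

lemma vabs_minus_commute: "vabs (x - y) = vabs (y - x)"
  using dist_vabs dist_commute by metis

lemma vabs_uminus [simp]: "vabs (- x) = vabs x"
  using vabs_minus_commute[of 0 x] by simp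

lemma vabs_inverse [simp]: "vabs (inverse x) = inverse (vabs x)"
  using vabs_mult[of x "inverse x"] by (cases "x = 0") (auto simp: field_simps)

lemma vabs_divide [simp]: "vabs (x / y) = vabs x / vabs y"
  by (simp add: divide_inverse vabs_mult)

lemma vabs_power [simp]: "vabs (x ^ n) = vabs x ^ n"
  by (induction n) (simp_all add: vabs_mult)

lemma vabs_diff_le_max: "vabs (x - y) \<le> max (vabs x) (vabs y)"
  using vabs_add_le_max[of x "- y"] by simp

lemma vabs_add_le: "vabs x \<le> r \<Longrightarrow> vabs y \<le> r \<Longrightarrow> vabs (x + y) \<le> r"
  using vabs_add_le_max[of x y] by linarith

lemma vabs_diff_le: "vabs x \<le> r \<Longrightarrow> vabs y \<le> r \<Longrightarrow> vabs (x - y) \<le> r"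
  using vabs_diff_le_max[of x y] by linarith

lemma vabs_add_less: "vabs x < r \<Longrightarrow> vabs y < r \<Longrightarrow> vabs (x + y) < r"
  using vabs_add_le_max[of x y] by linarith

lemma vabs_trans_le: "vabs (x - y) \<le> r \<Longrightarrow> vabs (y - z) \<le> r \<Longrightarrow> vabs (x - z) \<le> r"
  using vabs_add_le[of "x - y" r "y - z"] by simp

section \<open>Matrices and the projective line\<close>

lemma vec2_eqI: "u $ 1 = v $ 1 \<Longrightarrow> u $ 2 = v $ 2 \<Longrightarrow> u = (v :: 'a^2)"
  by (simp add: vec_eq_iff forall_2)

lemma matrix_vec2:
  "(A *v v) $ i = A $ i $ 1 * v $ 1 + A $ i $ 2 * v $ 2" for A :: "'a::field^2^2"
  by (simp add: matrix_vector_mult_def sum_2)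

lemma PGL2_class_eq: "PGL2_class A = {mat c ** A | c. c \<noteq> 0}"
  by (auto simp: PGL2_class_def r_coset_def scalars_def GL2_def)

lemma carrier_PGL2: "carrier PGL2 = PGL2_class ` {A. invertible A}"
  by (auto simp: PGL2_def carrier_FactGroup GL2_def PGL2_class_def)

lemma one_PGL2: "\<one>\<^bsub>PGL2\<^esub> = scalars"
  by (simp add: PGL2_def)

lemma mem_mult_PGL2: "A \<in> \<gamma> \<Longrightarrow> B \<in> \<delta> \<Longrightarrow> A ** B \<in> \<gamma> \<otimes>\<^bsub>PGL2\<^esub> \<delta>"
  by (auto simp: PGL2_def set_mult_def GL2_def)

lemma mem_one_PGL2: "mat 1 \<in> \<one>\<^bsub>PGL2\<^esub>"
  by (auto simp: one_PGL2 scalars_def)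

lemma mat_mult_vec: "mat c *v v = c *s v" for v :: "'a::field^2"
  by (auto simp: vec_eq_iff matrix_vector_mult_def mat_def sum_2 forall_2)

lemma mat_mult_vec_scale: "(mat c ** A) *v v = c *s (A *v v)" for A :: "'a::field^2^2"
  by (simp add: matrix_vector_mul_assoc[symmetric] mat_mult_vec)

lemma PGL2_invertible: "\<gamma> \<in> carrier PGL2 \<Longrightarrow> A \<in> \<gamma> \<Longrightarrow> invertible A"
  using mat_in_GL2 by (fastforce simp: carrier_PGL2 PGL2_class_eq GL2_def intro: invertible_mult)

lemma PGL2_class_self: "A \<in> PGL2_class A"
  by (auto simp: PGL2_class_eq intro!: exI[of _ 1])

lemma PGL2_mem_eq:
  assumes "\<gamma> \<in> carrier PGL2" "A \<in> \<gamma>"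
  shows "\<gamma> = PGL2_class A"
proof -
  from assms obtain B c where B: "\<gamma> = PGL2_class B" "c \<noteq> 0" "A = mat c ** B"
    by (auto simp: carrier_PGL2 PGL2_class_eq)
  have "mat d ** B = mat (d / c) ** A" for d
    using B by (simp add: matrix_mul_assoc mat_mult_mat)
  then have "{mat d ** B | d. d \<noteq> 0} \<subseteq> {mat d ** A | d. d \<noteq> 0}"
    using B(2) by (smt (verit) Collect_mono divide_eq_0_iff)
  moreover have "mat d ** A = mat (d * c) ** B" for d
    using B by (simp add: matrix_mul_assoc mat_mult_mat)
  then have "{mat d ** A | d. d \<noteq> 0} \<subseteq> {mat d ** B | d. d \<noteq> 0}"
    using B(2) by (smt (verit) Collect_mono mult_eq_0_iff)
  ultimately show ?thesis using B(1) by (simp add: PGL2_class_eq)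
qed

lemma PGL2_nonempty: "\<gamma> \<in> carrier PGL2 \<Longrightarrow> \<exists>A. A \<in> \<gamma>"
  using PGL2_class_self by (fastforce simp: carrier_PGL2)

lemma PGL2_mem_scale:
  assumes "\<gamma> \<in> carrier PGL2" "A \<in> \<gamma>" "c \<noteq> 0"
  shows "mat c ** A \<in> \<gamma>"
  using PGL2_mem_eq[OF assms(1,2)] assms(3) by (auto simp: PGL2_class_eq)

lemma PGL2_mem_unique:
  assumes "\<gamma> \<in> carrier PGL2" "A \<in> \<gamma>" "B \<in> \<gamma>"
  obtains c where "c \<noteq> 0" "B = mat c ** A"
  using PGL2_mem_eq[OF assms(1,2)] assms(3) by (auto simp: PGL2_class_eq)

lemma PGL2_eqI:
  assumes "\<gamma> \<in> carrier PGL2" "\<delta> \<in> carrier PGL2" "A \<in> \<gamma>" "A \<in> \<delta>"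
  shows "\<gamma> = \<delta>"
  using PGL2_mem_eq assms by metis

lemma mem_inv_PGL2:
  assumes "\<gamma> \<in> carrier PGL2" "A \<in> \<gamma>" "A ** B = mat 1"
  shows "B \<in> inv\<^bsub>PGL2\<^esub> \<gamma>"
proof -
  have "B ** A = mat 1" using assms(3) matrix_left_right_inverse by blast
  interpret Group.group PGL2 by (rule group_PGL2)
  have B: "PGL2_class B \<in> carrier PGL2"
    using assms(3) \<open>B ** A = mat 1\<close> by (auto simp: carrier_PGL2 invertible_def)
  have "PGL2_class B \<otimes>\<^bsub>PGL2\<^esub> \<gamma> = \<one>\<^bsub>PGL2\<^esub>"
    by (rule PGL2_eqI[of _ _ "mat 1"])
      (use B assms mem_mult_PGL2[OF PGL2_class_self assms(2), of B] \<open>B ** A = mat 1\<close> mem_one_PGL2 in auto)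
  then have "inv\<^bsub>PGL2\<^esub> \<gamma> = PGL2_class B" using inv_equality B assms by blast
  then show ?thesis using PGL2_class_self by simp
qed

text \<open>The power is represented through iterates on vectors, the form in which orbits and
  eigenvalues use it.\<close>

lemma mem_pow_PGL2:
  assumes "A \<in> \<gamma>"
  shows "\<exists>B \<in> \<gamma> [^]\<^bsub>PGL2\<^esub> (n::nat). \<forall>v. B *v v = ((*v) A ^^ n) v"
proof (induction n)
  case 0
  then show ?case using mem_one_PGL2 by (auto simp: nat_pow_def intro!: bexI[of _ "mat 1"])
next
  case (Suc n)
  then obtain B where B: "B \<in> \<gamma> [^]\<^bsub>PGL2\<^esub> n" "\<And>v. B *v v = ((*v) A ^^ n) v" by blast
  have "B ** A \<in> \<gamma> [^]\<^bsub>PGL2\<^esub> Suc n" using mem_mult_PGL2[OF B(1) assms] by (simp add: nat_pow_def)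
  then show ?case using B(2)
    by (intro bexI[of _ "B ** A"]) (auto simp: matrix_vector_mul_assoc[symmetric] funpow_swap1)
qed

lemma proj_point_scale:
  assumes "c \<noteq> 0"
  shows "proj_point (c *s v) = proj_point v"
proof -
  have "bij (\<lambda>d. d * c)" 
    using assms by (intro bij_betw_byWitness[where f' = "\<lambda>d. d / c"]) auto
  then have "range (\<lambda>d. d * c) = UNIV" by (simp add: bij_is_surj)
  then have "(\<lambda>d. d *s v) ` UNIV = (\<lambda>d. d *s v) ` range (\<lambda>d. d * c)" by simp
  then show ?thesis by (simp add: proj_point_def image_image vector_smult_assoc)
qed

lemma proj_point_self: "v \<in> proj_point v"
  by (auto simp: proj_point_def image_iff intro!: exI[of _ 1])

lemma matrix_vec_scale: "A *v (d *s v) = d *s (A *v v)" for A :: "'a::field^2^2"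
  by (simp add: matrix_vector_mult_def vec_eq_iff sum_distrib_left mult.left_commute)

lemma P1_act_proj_point:
  assumes "\<gamma> \<in> carrier PGL2" "A \<in> \<gamma>"
  shows "P1_act \<gamma> (proj_point v) = proj_point (A *v v)"
proof -
  have "(*v) B ` proj_point v = proj_point (A *v v)" if B: "B \<in> \<gamma>" for B
  proof -
    obtain c where c: "c \<noteq> 0" "B = mat c ** A" using PGL2_mem_unique[OF assms B] by metis
    have "(*v) B ` proj_point v = proj_point (c *s (A *v v))"
      unfolding proj_point_def image_image by (simp add: c mat_mult_vec_scale matrix_vec_scale vector_smult_assoc mult.commute)
    then show ?thesis using proj_point_scale[OF c(1)] by simp
  qed
  then show ?thesis unfolding P1_act_def using assms(2) by auto
qed

section \<open>Isometries and limit points\<close>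

text \<open>The gauge of the lattice \<^const>\<open>ball_lattice\<close>, on all of the plane.\<close>
definition ball_gauge :: "'a::complete_valued_field \<Rightarrow> real \<Rightarrow> 'a^2 \<Rightarrow> real" where
  "ball_gauge x r v = max (vabs (v $ 1 - v $ 2 * x) / r) (vabs (v $ 2))"

lemma ball_gauge_scale: "r > 0 \<Longrightarrow> ball_gauge x r (c *s v) = vabs c * ball_gauge x r v"
  using vabs_mult[of c "v $ 1 - v $ 2 * x"]
  by (simp add: ball_gauge_def vabs_mult right_diff_distrib mult.assoc max_mult_distrib_left)

lemma ball_gauge_nonneg: "ball_gauge x r v \<ge> 0"
  by (simp add: ball_gauge_def le_max_iff_disj)

lemma ball_gauge_eq_0_iff:
  assumes "r > 0"
  shows "ball_gauge x r v = 0 \<longleftrightarrow> v = 0"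
proof
  assume "ball_gauge x r v = 0"
  then have "vabs (v $ 1 - v $ 2 * x) / r \<le> 0" "vabs (v $ 2) \<le> 0"
    unfolding ball_gauge_def using max.cobounded1 max.cobounded2 by metis+
  then have "vabs (v $ 1 - v $ 2 * x) = 0" "vabs (v $ 2) = 0"
    using assms vabs_nonneg[of "v $ 1 - v $ 2 * x"] vabs_nonneg[of "v $ 2"]
    by (auto simp only: divide_le_0_iff)
  then show "v = 0" by (simp add: vec_eq_iff forall_2)
qed (simp add: ball_gauge_def)

lemma ball_gauge_pos_iff: "r > 0 \<Longrightarrow> ball_gauge x r v > 0 \<longleftrightarrow> v \<noteq> 0"
  using ball_gauge_nonneg[of x r v] ball_gauge_eq_0_iff[of r x v] by linarith

lemma ball_gauge_add_le:
  assumes "r > 0" "ball_gauge x r v \<le> s" "ball_gauge x r w \<le> s"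
  shows "ball_gauge x r (v + w) \<le> s"
proof -
  have "vabs ((v $ 1 - v $ 2 * x) + (w $ 1 - w $ 2 * x)) \<le> s * r"
    using assms by (intro vabs_add_le) (auto simp: ball_gauge_def pos_divide_le_eq)
  moreover have "(v $ 1 - v $ 2 * x) + (w $ 1 - w $ 2 * x) = (v + w) $ 1 - (v + w) $ 2 * x"
    by (simp add: algebra_simps)
  moreover have "vabs (v $ 2 + w $ 2) \<le> s"
    using assms by (intro vabs_add_le) (auto simp: ball_gauge_def)
  ultimately show ?thesis using assms(1) by (simp add: ball_gauge_def pos_divide_le_eq)
qed

lemma ball_gauge_uminus [simp]: "ball_gauge x r (- v) = ball_gauge x r v"
proof -
  have "vabs (- v $ 1 + v $ 2 * x) = vabs (v $ 1 - v $ 2 * x)"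
    using vabs_uminus[of "v $ 1 - v $ 2 * x"] by simp
  then show ?thesis by (simp add: ball_gauge_def)
qed

lemma ball_gauge_add_less:
  assumes "r > 0" "ball_gauge x r v < s" "ball_gauge x r w < s"
  shows "ball_gauge x r (v + w) < s"
  using ball_gauge_add_le[OF assms(1), of x v "max (ball_gauge x r v) (ball_gauge x r w)" w] assms by linarith

lemma ball_gauge_diff_commute: "ball_gauge x r (v - w) = ball_gauge x r (w - v)"
  using ball_gauge_uminus[of x r "v - w"] by simp

text \<open>This is the isosceles property of ultrametric norms. Because of it, all representatives
  in a neighbourhood of relative radius at most 1 have the same size.\<close>

lemma ball_gauge_eq_of_close:
  assumes "r > 0" "ball_gauge x r (v - w) < ball_gauge x r w"
  shows "ball_gauge x r v = ball_gauge x r w"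
proof (rule antisym)
  show "ball_gauge x r v \<le> ball_gauge x r w"
    using ball_gauge_add_le[OF assms(1), of x "v - w" "ball_gauge x r w" w] assms by simp
  show "ball_gauge x r w \<le> ball_gauge x r v"
  proof (rule ccontr)
    assume "\<not> ball_gauge x r w \<le> ball_gauge x r v"
    then have "ball_gauge x r (v + (w - v)) < ball_gauge x r w"
      using assms by (intro ball_gauge_add_less) (auto simp: ball_gauge_diff_commute)
    then show False by simp
  qed
qed

section \<open>Comparison of the gauge with the topology of the projective line\<close>

lemma vabs_nth_le_dist: "vabs ((v - w) $ i) \<le> dist v w" for v w :: "'a::complete_valued_field^2"
  using dist_vec_nth_le[of v i w] by (simp add: dist_vabs)

text \<open>Together with \<open>dist_le_gauge\<close> this makes the gauge equivalent to the metric
  of the plane. The topology of the projective line is defined through that metric, and the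
  equivalence allows it to be tested by gauges.\<close>

lemma ball_gauge_le_dist:
  assumes "r > 0"
  shows "\<exists>C>0. \<forall>v w. ball_gauge x r (v - w) \<le> C * dist v w"
proof (intro exI conjI allI)
  define C where "C = max ((max 1 (vabs x)) / r) 1"
  show "C > 0" by (simp add: C_def less_max_iff_disj)
  fix v w :: "'a^2"
  have "vabs ((v - w) $ 1 - (v - w) $ 2 * x) \<le> max 1 (vabs x) * dist v w"
  proof (rule vabs_diff_le)
    show "vabs ((v - w) $ 1) \<le> max 1 (vabs x) * dist v w"
      using vabs_nth_le_dist[of v w 1] mult_right_mono[of 1 "max 1 (vabs x)" "dist v w"] by simp
    show "vabs ((v - w) $ 2 * x) \<le> max 1 (vabs x) * dist v w"
      unfolding vabs_mult mult.commute[of "vabs ((v - w) $ 2)"]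
      using vabs_nth_le_dist[of v w 2] by (intro mult_mono) auto
  qed
  then have "vabs ((v - w) $ 1 - (v - w) $ 2 * x) / r \<le> (max 1 (vabs x)) / r * dist v w"
    using assms by (simp add: field_simps)
  also have "\<dots> \<le> C * dist v w" by (intro mult_right_mono) (auto simp: C_def)
  finally have 1: "vabs ((v - w) $ 1 - (v - w) $ 2 * x) / r \<le> C * dist v w" .
  have "vabs ((v - w) $ 2) \<le> 1 * dist v w" using vabs_nth_le_dist[of v w 2] by simp
  also have "\<dots> \<le> C * dist v w" by (intro mult_right_mono) (auto simp: C_def)
  finally show "ball_gauge x r (v - w) \<le> C * dist v w" using 1 by (simp add: ball_gauge_def)
qed

lemma dist_le_gauge:
  assumes "r > 0"
  shows "\<exists>C>0. \<forall>v w. dist v w \<le> C * ball_gauge x r (v - w)"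
proof (intro exI conjI allI)
  \<comment> \<open>The constant m bounds the first coordinate, written as
    \<open>(v1 - v2 x) + v2 x\<close>. The summand 1 in \<open>m + 1\<close> accounts for the second
    coordinate, as the distance is estimated by the sum over both.\<close>
  define m where "m = max r (vabs x)"
  have m: "m > 0" using assms by (simp add: m_def less_max_iff_disj)
  show "m + 1 > 0" using m by simp
  fix v w :: "'a^2"
  let ?g = "ball_gauge x r (v - w)"
  have 2: "vabs ((v - w) $ 2) \<le> ?g" by (simp add: ball_gauge_def)
  have 1: "vabs ((v - w) $ 1) \<le> m * ?g"
  proof -
    have "vabs (((v - w) $ 1 - (v - w) $ 2 * x) + (v - w) $ 2 * x) \<le> m * ?g"
    proof (rule vabs_add_le)
      have "vabs ((v - w) $ 1 - (v - w) $ 2 * x) \<le> r * ?g"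
        using assms by (simp add: ball_gauge_def max_def field_simps)
      also have "\<dots> \<le> m * ?g" by (intro mult_right_mono ball_gauge_nonneg) (simp add: m_def)
      finally show "vabs ((v - w) $ 1 - (v - w) $ 2 * x) \<le> m * ?g" .
      show "vabs ((v - w) $ 2 * x) \<le> m * ?g"
        unfolding vabs_mult mult.commute[of "vabs ((v - w) $ 2)"]
        using 2 m by (intro mult_mono) (auto simp: m_def)
    qed
    then show ?thesis by simp
  qed
  have "dist v w \<le> (\<Sum>i\<in>UNIV. dist (v $ i) (w $ i))"
    unfolding dist_vec_def by (rule L2_set_le_sum) simp
  also have "\<dots> = vabs ((v - w) $ 1) + vabs ((v - w) $ 2)"
    by (simp add: sum_2 dist_vabs)
  also have "\<dots> \<le> (m + 1) * ?g" using 1 2 by (simp add: distrib_right)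
  finally show "dist v w \<le> (m + 1) * ?g" .
qed

lemma topspace_P1_topology: "topspace P1_topology = (P1 :: ('a::complete_valued_field^2) set set)"
proof
  show "topspace P1_topology \<subseteq> (P1 :: ('a^2) set set)"
    using openin_topspace[of P1_topology] unfolding openin_P1 by blast
  have "{v :: 'a^2. v \<noteq> 0 \<and> proj_point v \<in> P1} = - {0}" by (auto simp: P1_def)
  moreover have "open (- {0 :: 'a^2})" by (rule open_Compl) simp
  ultimately have "openin P1_topology (P1 :: ('a^2) set set)" by (simp add: openin_P1)
  then show "(P1 :: ('a^2) set set) \<subseteq> topspace P1_topology" by (rule openin_subset)
qed

lemma proj_point_eqD:
  assumes "proj_point v = proj_point w" "v \<noteq> 0"
  obtains c where "c \<noteq> 0" "v = c *s w"
  using assms proj_point_self[of v] by (auto simp: proj_point_def)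

text \<open>The radius is relative to the gauge of \<open>w\<close>, so that rescaling a nonzero
  \<open>w\<close> does not change the set: it depends only on the point that \<open>w\<close>
  represents.\<close>

definition ball_gauge_nbhd :: "'a::complete_valued_field \<Rightarrow> real \<Rightarrow> real \<Rightarrow> 'a^2 \<Rightarrow> ('a^2) set set" where
  "ball_gauge_nbhd x r \<epsilon> w = {proj_point v | v. v \<noteq> 0 \<and> ball_gauge x r (v - w) < \<epsilon> * ball_gauge x r w}"

lemma openin_gauge_nbhd:
  assumes "r > 0"
  shows "openin P1_topology (ball_gauge_nbhd x r \<epsilon> w)"
  unfolding openin_P1
proof
  show "ball_gauge_nbhd x r \<epsilon> w \<subseteq> P1" by (auto simp: ball_gauge_nbhd_def P1_def)
  show "open {v. v \<noteq> 0 \<and> proj_point v \<in> ball_gauge_nbhd x r \<epsilon> w}"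
    unfolding open_dist
  proof safe
    fix v assume v: "v \<noteq> 0" "proj_point v \<in> ball_gauge_nbhd x r \<epsilon> w"
    then obtain u where u: "proj_point u = proj_point v" "u \<noteq> 0" "ball_gauge x r (u - w) < \<epsilon> * ball_gauge x r w"
      by (auto simp: ball_gauge_nbhd_def)
    obtain c where c: "c \<noteq> 0" "u = c *s v" using proj_point_eqD[OF u(1,2)] by metis
    obtain C where C: "C > 0" "\<And>v w. ball_gauge x r (v - w) \<le> C * dist v w"
      using ball_gauge_le_dist[OF assms] by blast
    have e: "0 < \<epsilon> * ball_gauge x r w" using u(3) ball_gauge_nonneg[of x r "u - w"] by linarith
    \<comment> \<open>The first bound keeps the rescaled vector \<open>c *s y\<close> close enough
      to \<open>u\<close>, the second keeps \<open>y\<close> away from 0.\<close>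
    define d where "d = min (\<epsilon> * ball_gauge x r w / (vabs c * C)) (dist v 0)"
    have "d > 0" using e c C v by (simp add: d_def)
    moreover have "y \<noteq> 0 \<and> proj_point y \<in> ball_gauge_nbhd x r \<epsilon> w" if "dist y v < d" for y
    proof -
      have y: "y \<noteq> 0" using that by (auto simp: d_def dist_commute)
      have "ball_gauge x r (c *s y - c *s v) = vabs c * ball_gauge x r (y - v)"
        using ball_gauge_scale[OF assms, of x c "y - v"] by (simp add: vector_ssub_ldistrib)
      also have "\<dots> \<le> vabs c * (C * dist y v)" using C by (intro mult_left_mono) auto
      also have "\<dots> < \<epsilon> * ball_gauge x r w"
        using that c C by (simp add: d_def pos_less_divide_eq mult_ac)
      finally have "ball_gauge x r ((c *s y - u) + (u - w)) < \<epsilon> * ball_gauge x r w"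
        using u(3) c by (intro ball_gauge_add_less[OF assms]) auto
      then have "proj_point (c *s y) \<in> ball_gauge_nbhd x r \<epsilon> w"
        using y c by (auto simp: ball_gauge_nbhd_def)
      then show ?thesis using y c(1) by (simp add: proj_point_scale)
    qed
    ultimately show "\<exists>e>0. \<forall>y. dist y v < e \<longrightarrow> y \<in> {v. v \<noteq> 0 \<and> proj_point v \<in> ball_gauge_nbhd x r \<epsilon> w}"
      by blast
  qed
qed

lemma ball_gauge_nbhd_base:
  assumes "r > 0" "openin P1_topology U" "w \<noteq> 0" "proj_point w \<in> U"
  shows "\<exists>\<epsilon>>0. ball_gauge_nbhd x r \<epsilon> w \<subseteq> U"
proof -
  obtain d where d: "d > 0" "\<And>v. dist v w < d \<Longrightarrow> v \<noteq> 0 \<and> proj_point v \<in> U"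
    using assms(2-4) unfolding openin_P1 open_dist by blast
  obtain C where C: "C > 0" "\<And>v w. dist v w \<le> C * ball_gauge x r (v - w)"
    using dist_le_gauge[OF assms(1)] by blast
  have g: "ball_gauge x r w > 0" using assms by (simp add: ball_gauge_pos_iff)
  define \<epsilon> where "\<epsilon> = d / (C * ball_gauge x r w)"
  have "\<epsilon> > 0" using d C g by (simp add: \<epsilon>_def)
  moreover have "dist v w < d" if "ball_gauge x r (v - w) < \<epsilon> * ball_gauge x r w" for v
  proof -
    have "dist v w \<le> C * ball_gauge x r (v - w)" by (rule C)
    also have "\<dots> < C * (\<epsilon> * ball_gauge x r w)" using that C by simp
    also have "\<dots> = d" using C g by (simp add: \<epsilon>_def)
    finally show ?thesis .
  qed
  ultimately show ?thesis using d(2) by (force simp: ball_gauge_nbhd_def)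
qed

section \<open>Recurrence under isometries of the gauge\<close>

text \<open>
  Pigeonhole principle on a finite cover of the orbit closure by small neighbourhoods: two far apart
  elements of the orbit lie in the same neighbourhood, and \<open>A\<close> acts by isometries of the gauge.
\<close>
lemma isometry_recurrence:
  assumes r: "r > 0" and iso: "\<And>v. ball_gauge x r (A *v v) = ball_gauge x r v"
    and K: "compactin P1_topology K" "\<And>n. proj_point (((*v) A ^^ n) v) \<in> K"
    and v: "v \<noteq> 0" and \<epsilon>: "\<epsilon> > 0"
  shows "\<exists>n>N. proj_point (((*v) A ^^ n) v) \<in> ball_gauge_nbhd x r \<epsilon> v"
proof -
  \<comment> \<open>The bound 1 ensures, by \<open>ball_gauge_eq_of_close\<close>, that a
    representative near \<open>w\<close> has the gauge of \<open>w\<close>; this yields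
    \<open>av\<close> below.\<close>
  define \<delta> where "\<delta> = min \<epsilon> 1"
  have \<delta>: "0 < \<delta>" "\<delta> \<le> 1" "\<delta> \<le> \<epsilon>" using \<epsilon> by (auto simp: \<delta>_def)
  let ?f = "(*v) A"
  have iso': "ball_gauge x r ((?f ^^ n) u) = ball_gauge x r u" for n u
    by (induction n) (simp_all add: iso)
  have lin: "(?f ^^ n) (c *s u) = c *s (?f ^^ n) u" for n c u
    by (induction n) (simp_all add: matrix_vec_scale)
  have lind: "(?f ^^ n) (u - w) = (?f ^^ n) u - (?f ^^ n) w" for n u w
    by (induction n) (simp_all add: matrix_vector_mult_diff_distrib)
  have KP: "K \<subseteq> P1" using K(1) by (simp add: compactin_def topspace_P1_topology)
  define \<U> where "\<U> = ball_gauge_nbhd x r \<delta> ` (- {0})"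
  have "K \<subseteq> \<Union>\<U>"
  proof
    fix y assume "y \<in> K"
    then obtain w where w: "w \<noteq> 0" "y = proj_point w" using KP by (auto simp: P1_def)
    then have "y \<in> ball_gauge_nbhd x r \<delta> w"
      using \<delta> ball_gauge_eq_0_iff[OF r, of x 0] ball_gauge_pos_iff[OF r, of x w] by (auto simp: ball_gauge_nbhd_def)
    then show "y \<in> \<Union>\<U>" using w by (auto simp: \<U>_def)
  qed
  moreover have "openin P1_topology U" if "U \<in> \<U>" for U
    using that openin_gauge_nbhd[OF r] by (auto simp: \<U>_def)
  ultimately obtain \<F> where \<F>: "finite \<F>" "\<F> \<subseteq> \<U>" "K \<subseteq> \<Union>\<F>"
    using K(1) unfolding compactin_def by blast
  have "\<exists>U\<in>\<F>. infinite {n. proj_point ((?f ^^ n) v) \<in> U}"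
  proof (rule ccontr)
    assume "\<not> ?thesis"
    then have "finite (\<Union>U\<in>\<F>. {n. proj_point ((?f ^^ n) v) \<in> U})" using \<F>(1) by blast
    moreover have "(\<Union>U\<in>\<F>. {n. proj_point ((?f ^^ n) v) \<in> U}) = UNIV" using K(2) \<F>(3) by blast
    ultimately show False by simp
  qed
  then obtain w where w: "w \<noteq> 0" "infinite {n. proj_point ((?f ^^ n) v) \<in> ball_gauge_nbhd x r \<delta> w}"
    using \<F>(2) by (auto simp: \<U>_def)
  obtain n where n: "proj_point ((?f ^^ n) v) \<in> ball_gauge_nbhd x r \<delta> w"
    using w(2) by (metis (mono_tags, lifting) Collect_empty_eq finite.emptyI)
  \<comment> \<open>The exponent of the return is going to be m - n, so m is taken beyond n +
    N.\<close>
  obtain m where m: "m > n + N" "proj_point ((?f ^^ m) v) \<in> ball_gauge_nbhd x r \<delta> w"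
    using w(2) unfolding infinite_nat_iff_unbounded by blast
  have *: "\<exists>c. c \<noteq> 0 \<and> ball_gauge x r (c *s u - w) < \<delta> * ball_gauge x r w"
    if "proj_point u \<in> ball_gauge_nbhd x r \<delta> w" for u
  proof -
    from that obtain u' where u': "proj_point u' = proj_point u" "u' \<noteq> 0" "ball_gauge x r (u' - w) < \<delta> * ball_gauge x r w"
      by (auto simp: ball_gauge_nbhd_def)
    then show ?thesis using proj_point_eqD[OF u'(1,2)] by metis
  qed
  obtain a where a: "a \<noteq> 0" "ball_gauge x r (a *s (?f ^^ n) v - w) < \<delta> * ball_gauge x r w" using *[OF n] by blast
  obtain b where b: "b \<noteq> 0" "ball_gauge x r (b *s (?f ^^ m) v - w) < \<delta> * ball_gauge x r w" using *[OF m(2)] by blast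
  have gw: "ball_gauge x r w > 0" using w r by (simp add: ball_gauge_pos_iff)
  have "ball_gauge x r (a *s (?f ^^ n) v) = ball_gauge x r w"
  proof (rule ball_gauge_eq_of_close[OF r])
    have "\<delta> * ball_gauge x r w \<le> ball_gauge x r w" using \<delta> gw by simp
    then show "ball_gauge x r (a *s (?f ^^ n) v - w) < ball_gauge x r w" using a(2) by linarith
  qed
  then have av: "vabs a * ball_gauge x r v = ball_gauge x r w"
    by (simp add: ball_gauge_scale[OF r] iso')
  define u where "u = (?f ^^ (m - n)) v"
  have mn: "(?f ^^ m) v = (?f ^^ n) u"
    using m(1) by (simp add: u_def funpow_add[symmetric] flip: comp_apply[of "?f ^^ n"])
  \<comment> \<open>Both rescaled orbit points are near \<open>w\<close>, hence near each other. The
    common factor \<open>?f ^^ n\<close> is a linear isometry and can be removed, which compares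
    \<open>u\<close> with \<open>v\<close> itself.\<close>
  have "ball_gauge x r ((b *s (?f ^^ m) v - w) + (w - a *s (?f ^^ n) v)) < \<delta> * ball_gauge x r w"
    using a b by (intro ball_gauge_add_less[OF r]) (auto simp: ball_gauge_diff_commute)
  then have "ball_gauge x r ((?f ^^ n) (b *s u - a *s v)) < \<delta> * ball_gauge x r w"
    by (simp add: mn lin lind)
  then have "ball_gauge x r (b *s u - a *s v) < \<delta> * (vabs a * ball_gauge x r v)"
    by (simp add: iso' av)
  moreover have "b *s u - a *s v = a *s ((b / a) *s u - v)"
    using a by (simp add: vector_ssub_ldistrib vector_smult_assoc)
  then have "ball_gauge x r (b *s u - a *s v) = vabs a * ball_gauge x r ((b / a) *s u - v)"
    by (metis ball_gauge_scale[OF r])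
  ultimately have "vabs a * ball_gauge x r ((b / a) *s u - v) < vabs a * (\<delta> * ball_gauge x r v)"
    by (simp only: mult_ac)
  then have "ball_gauge x r ((b / a) *s u - v) < \<delta> * ball_gauge x r v"
    using a by simp
  also have "\<dots> \<le> \<epsilon> * ball_gauge x r v" using \<delta> by (intro mult_right_mono ball_gauge_nonneg) auto
  finally have lt: "ball_gauge x r ((b / a) *s u - v) < \<epsilon> * ball_gauge x r v" .
  have "ball_gauge x r u = ball_gauge x r v" by (simp add: u_def iso')
  then have "u \<noteq> 0" using v r by (metis ball_gauge_eq_0_iff)
  then have "proj_point ((b / a) *s u) \<in> ball_gauge_nbhd x r \<epsilon> v"
    using lt a b by (auto simp: ball_gauge_nbhd_def)
  then have "proj_point u \<in> ball_gauge_nbhd x r \<epsilon> v" using a b by (simp add: proj_point_scale)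
  then show ?thesis using m(1) by (intro exI[of _ "m - n"]) (auto simp: u_def)
qed

lemma isometry_finite_order:
  assumes G: "discontinuous G" and \<gamma>: "\<gamma> \<in> G" "A \<in> \<gamma>"
    and r: "r > 0" and iso: "\<And>v. ball_gauge x r (A *v v) = ball_gauge x r v"
  shows "\<exists>n>0. \<gamma> [^]\<^bsub>PGL2\<^esub> (n::nat) = \<one>\<^bsub>PGL2\<^esub>"
proof (rule ccontr)
  assume no: "\<not> ?thesis"
  interpret P: Group.group PGL2 by (rule group_PGL2)
  interpret G: subgroup G PGL2 using G by (simp add: discontinuous_def)
  have \<gamma>c: "\<gamma> \<in> carrier PGL2" using \<gamma> by simp
  have pow: "\<gamma> [^]\<^bsub>PGL2\<^esub> (n::nat) \<in> G" for n
    by (induction n) (use \<gamma> in auto)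
  have inj: "\<gamma> [^]\<^bsub>PGL2\<^esub> m \<noteq> \<gamma> [^]\<^bsub>PGL2\<^esub> n" if "m < n" for m n :: nat
  proof
    assume eq: "\<gamma> [^]\<^bsub>PGL2\<^esub> m = \<gamma> [^]\<^bsub>PGL2\<^esub> n"
    have "\<gamma> [^]\<^bsub>PGL2\<^esub> m \<otimes>\<^bsub>PGL2\<^esub> \<gamma> [^]\<^bsub>PGL2\<^esub> (n - m) = \<gamma> [^]\<^bsub>PGL2\<^esub> n"
      using P.nat_pow_mult[OF \<gamma>c, of m "n - m"] that by simp
    also have "\<dots> = \<gamma> [^]\<^bsub>PGL2\<^esub> m \<otimes>\<^bsub>PGL2\<^esub> \<one>\<^bsub>PGL2\<^esub>" using eq \<gamma>c by simp
    finally have "\<gamma> [^]\<^bsub>PGL2\<^esub> (n - m) = \<one>\<^bsub>PGL2\<^esub>"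
      using P.l_cancel \<gamma>c by (metis P.nat_pow_closed P.one_closed)
    moreover have "n - m > 0" using that by simp
    ultimately show False using no by blast
  qed
  have act: "P1_act (\<gamma> [^]\<^bsub>PGL2\<^esub> (n::nat)) (proj_point v) = proj_point (((*v) A ^^ n) v)" for n v
  proof -
    obtain B where "B \<in> \<gamma> [^]\<^bsub>PGL2\<^esub> n" "\<And>v. B *v v = ((*v) A ^^ n) v"
      using mem_pow_PGL2[OF \<gamma>(2)] by blast
    then show ?thesis using P1_act_proj_point[of "\<gamma> [^]\<^bsub>PGL2\<^esub> n" B v] \<gamma>c by simp
  qed
  obtain y where y: "y \<in> P1" "y \<notin> limit_points G"
    using G by (auto simp: discontinuous_def ordinary_points_def)
  obtain v where v: "v \<noteq> 0" "y = proj_point v" using y by (auto simp: P1_def)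
  let ?K = "P1_topology closure_of {P1_act \<gamma> y | \<gamma>. \<gamma> \<in> G}"
  have K: "compactin P1_topology ?K" using G y by (auto simp: discontinuous_def)
  have inP1: "P1_act \<delta> y \<in> P1" if "\<delta> \<in> G" for \<delta>
  proof -
    have \<delta>: "\<delta> \<in> carrier PGL2" using that by simp
    obtain B where B: "B \<in> \<delta>" using PGL2_nonempty[OF \<delta>] by blast
    have "invertible B" using PGL2_invertible[OF \<delta> B] .
    then have "B *v v \<noteq> 0" using v(1)
      by (metis invertible_def matrix_vector_mul_assoc matrix_vector_mul_lid matrix_vector_mult_0_right)
    then show ?thesis using P1_act_proj_point[OF \<delta> B, of v] v by (simp add: P1_def)
  qed
  have "proj_point (((*v) A ^^ n) v) \<in> ?K" for n
  proof -
    have "P1_act (\<gamma> [^]\<^bsub>PGL2\<^esub> n) y \<in> {P1_act \<gamma> y | \<gamma>. \<gamma> \<in> G}" using pow by blast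
    moreover have "{P1_act \<gamma> y | \<gamma>. \<gamma> \<in> G} \<subseteq> ?K"
      using inP1 by (intro closure_of_subset) (auto simp: topspace_P1_topology)
    ultimately show ?thesis using act v by auto
  qed
  note rec = isometry_recurrence[OF r iso K this v(1)]
  \<comment> \<open>Increasing exponents make the chosen powers pairwise different, as the
    definition of limit points demands; the radii 1/(j+1) force convergence to
    \<open>y\<close>.\<close>
  have "\<exists>s :: nat \<Rightarrow> nat. \<forall>j. (proj_point (((*v) A ^^ s j) v) \<in> ball_gauge_nbhd x r (inverse (Suc j)) v) \<and> s j < s (Suc j)"
  proof (rule dependent_nat_choice)
    show "\<exists>n. proj_point (((*v) A ^^ n) v) \<in> ball_gauge_nbhd x r (inverse (Suc 0)) v"
      using rec[of "inverse (Suc 0)" 0] by auto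
    show "\<exists>m. proj_point (((*v) A ^^ m) v) \<in> ball_gauge_nbhd x r (inverse (Suc (Suc j))) v \<and> n < m" for n j
      using rec[of "inverse (Suc (Suc j))" n] by auto
  qed
  then obtain s where s: "\<And>j. proj_point (((*v) A ^^ s j) v) \<in> ball_gauge_nbhd x r (inverse (Suc j)) v"
    "\<And>j. s j < s (Suc j)" by blast
  have "strict_mono s" using s(2) by (simp add: strict_mono_Suc_iff)
  then have "inj (\<lambda>j. \<gamma> [^]\<^bsub>PGL2\<^esub> s j)"
    by (intro injI) (metis inj linorder_less_linear strict_mono_eq)
  moreover have "limitin P1_topology (\<lambda>j. P1_act (\<gamma> [^]\<^bsub>PGL2\<^esub> s j) y) y sequentially"
    unfolding limitin_def
  proof (intro conjI allI impI)
    show "y \<in> topspace P1_topology" using y by (simp add: topspace_P1_topology)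
    fix U assume U: "openin P1_topology U \<and> y \<in> U"
    then obtain \<epsilon> where \<epsilon>: "\<epsilon> > 0" "ball_gauge_nbhd x r \<epsilon> v \<subseteq> U"
      using ball_gauge_nbhd_base[OF r _ v(1), of U x] v(2) by blast
    have "\<forall>\<^sub>F j in sequentially. inverse (real (Suc j)) < \<epsilon>"
      using LIMSEQ_inverse_real_of_nat \<epsilon>(1) by (rule order_tendstoD(2))
    then show "\<forall>\<^sub>F j in sequentially. P1_act (\<gamma> [^]\<^bsub>PGL2\<^esub> s j) y \<in> U"
    proof eventually_elim
      case (elim j)
      have "ball_gauge_nbhd x r (inverse (Suc j)) v \<subseteq> ball_gauge_nbhd x r \<epsilon> v"
        using elim mult_right_mono[OF less_imp_le[OF elim] ball_gauge_nonneg[of x r v]]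
        by (force simp: ball_gauge_nbhd_def)
      then show ?case using s(1)[of j] \<epsilon>(2) act v(2) by auto
    qed
  qed
  ultimately have "y \<in> limit_points G"
    using y pow unfolding limit_points_def by blast
  then show False using y by simp
qed

section \<open>Lattices and the action on the tree\<close>

text \<open>The closure rules concern the operations of the type class, so that they can serve the
  simplifier; \<open>subfield_set_generate_field\<close> transfers a generated field of HOL-Algebra
  to this form.\<close>

locale subfield_set =
  fixes k :: "'a::complete_valued_field set"
  assumes one [simp]: "1 \<in> k"
    and uminus [simp]: "x \<in> k \<Longrightarrow> - x \<in> k"
    and inverse [simp]: "x \<in> k \<Longrightarrow> inverse x \<in> k"
    and add [simp]: "x \<in> k \<Longrightarrow> y \<in> k \<Longrightarrow> x + y \<in> k"
    and mult [simp]: "x \<in> k \<Longrightarrow> y \<in> k \<Longrightarrow> x * y \<in> k"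
begin

lemma zero [simp]: "0 \<in> k"
  using add[OF one uminus[OF one]] by simp

lemma diff [simp]: "x \<in> k \<Longrightarrow> y \<in> k \<Longrightarrow> x - y \<in> k"
  using add[of x "- y"] by simp

lemma divide [simp]: "x \<in> k \<Longrightarrow> y \<in> k \<Longrightarrow> x / y \<in> k"
  by (simp add: divide_inverse)

lemma power [simp]: "x \<in> k \<Longrightarrow> x ^ n \<in> k"
  by (induction n) simp_all

end

lemma inv_ring_of_type_algebra:
  assumes "(x :: 'a::field) \<noteq> 0"
  shows "inv\<^bsub>ring_of_type_algebra\<^esub> x = inverse x"
proof -
  interpret cring "ring_of_type_algebra :: 'a ring" by (rule cring_from_type_algebra)
  show ?thesis by (rule comm_inv_char) (use assms in \<open>auto simp: ring_of_type_algebra_def\<close>)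
qed

lemma subfield_set_generate_field:
  "subfield_set (generate_field ring_of_type_algebra (S :: 'a::complete_valued_field set))"
    (is "subfield_set ?k")
proof
  interpret cring "ring_of_type_algebra :: 'a ring" by (rule cring_from_type_algebra)
  have "1 = \<one>\<^bsub>ring_of_type_algebra :: 'a ring\<^esub>" by (simp add: ring_of_type_algebra_def)
  then show one: "1 \<in> ?k" using generate_field.one by metis
  show add: "x + y \<in> ?k" if "x \<in> ?k" "y \<in> ?k" for x y
    using generate_field.eng_add[OF that] by (simp add: ring_of_type_algebra_def)
  show mult: "x * y \<in> ?k" if "x \<in> ?k" "y \<in> ?k" for x y
    using generate_field.eng_mult[OF that] by (simp add: ring_of_type_algebra_def)
  have neg: "\<ominus>\<^bsub>ring_of_type_algebra\<^esub> x = - x" for x :: 'a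
    by (rule minus_equality) (auto simp: ring_of_type_algebra_def)
  show uminus: "- x \<in> ?k" if "x \<in> ?k" for x
    using generate_field.a_inv[OF that] neg by simp
  show "inverse x \<in> ?k" if "x \<in> ?k" for x
  proof (cases "x = 0")
    case False
    then show ?thesis
      using generate_field.m_inv[OF that] by (simp add: inv_ring_of_type_algebra) (simp add: ring_of_type_algebra_def)
  qed (use that in simp)
qed

definition matrix_over :: "'a set \<Rightarrow> 'a^2^2 \<Rightarrow> bool" where
  "matrix_over k A \<longleftrightarrow> (\<forall>i j. A $ i $ j \<in> k)"

definition PGL2_over :: "'a::field set \<Rightarrow> ('a^2^2) set set" where
  "PGL2_over k = {\<gamma> \<in> carrier PGL2. \<exists>A\<in>\<gamma>. matrix_over k A}"

text \<open>The span over the valuation ring of \<open>k\<close>.\<close>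
definition ospan :: "'a::complete_valued_field set \<Rightarrow> 'a^2 \<Rightarrow> 'a^2 \<Rightarrow> ('a^2) set" where
  "ospan k u w = {s *s u + t *s w | s t. s \<in> k \<and> t \<in> k \<and> vabs s \<le> 1 \<and> vabs t \<le> 1}"

lemma ospan_commute: "ospan k u w = ospan k w u"
proof -
  have "ospan k u w \<subseteq> ospan k w u" for u w
  proof
    fix v assume "v \<in> ospan k u w"
    then obtain s t where "v = t *s w + s *s u" "s \<in> k" "t \<in> k" "vabs s \<le> 1" "vabs t \<le> 1"
      by (auto simp: ospan_def add.commute)
    then show "v \<in> ospan k w u" unfolding ospan_def by blast
  qed
  then show ?thesis by blast
qed

lemma image_ospan: "(*v) A ` ospan k u w = ospan k (A *v u) (A *v w)"
proof -
  have "(*v) A ` {f s t | s t. P s t} = {A *v f s t | s t. P s t}" for f and P :: "'a \<Rightarrow> 'a \<Rightarrow> bool"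
    by blast
  then show ?thesis unfolding ospan_def by (simp add: matrix_vector_right_distrib matrix_vec_scale)
qed

definition kballs :: "'a::complete_valued_field set \<Rightarrow> 'a set set" where
  "kballs k = {kball k x r | x r. x \<in> k \<and> r \<in> value_group k}"

text \<open>All lattices in this union coincide, see \<open>lat_kball\<close> below.\<close>
definition lat :: "'a::complete_valued_field set \<Rightarrow> 'a set \<Rightarrow> ('a^2) set" where
  "lat k B = (\<Union>(x, r)\<in>{(x, r). x \<in> k \<and> r \<in> value_group k \<and> B = kball k x r}. ball_lattice k x r)"

lemma kballs_cases:
  assumes "B \<in> kballs k"
  obtains x a where "x \<in> k" "a \<in> k" "a \<noteq> 0" "B = kball k x (vabs a)"
  using assms unfolding kballs_def value_group_def by blast

lemma kballs_memI: "x \<in> k \<Longrightarrow> r \<in> value_group k \<Longrightarrow> kball k x r \<in> kballs k"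
  by (auto simp: kballs_def)

lemma value_groupI: "a \<in> k \<Longrightarrow> a \<noteq> 0 \<Longrightarrow> vabs a \<in> value_group k"
  by (auto simp: value_group_def)

lemma value_group_pos: "r \<in> value_group k \<Longrightarrow> r > 0"
  by (auto simp: value_group_def)

lemma ball_lattice_ball_gauge:
  "r > 0 \<Longrightarrow> ball_lattice k x r = {v. v $ 1 \<in> k \<and> v $ 2 \<in> k \<and> ball_gauge x r v \<le> 1}"
  by (auto simp: ball_lattice_def ball_gauge_def)

text \<open>The expression in \<open>u\<close> and \<open>w\<close> is the determinant of the matrix
  with these columns, so \<open>A\<close> multiplies it by \<open>det A\<close>.\<close>

lemma independent_image:
  fixes A :: "'a::field^2^2"
  assumes "invertible A" "u $ 1 * w $ 2 - u $ 2 * w $ 1 \<noteq> 0"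
  shows "(A *v u) $ 1 * (A *v w) $ 2 - (A *v u) $ 2 * (A *v w) $ 1 \<noteq> 0"
proof -
  have "(A *v u) $ 1 * (A *v w) $ 2 - (A *v u) $ 2 * (A *v w) $ 1
      = det A * (u $ 1 * w $ 2 - u $ 2 * w $ 1)"
    by (simp add: matrix_vec2 det_2 algebra_simps)
  then show ?thesis using assms by (simp add: invertible_det_nz)
qed

context subfield_set
begin

text \<open>A radius in the value group is attained: \<open>x + a\<close> lies in the ball and has
  distance \<open>vabs a = r\<close> from \<open>x\<close>. So a ball determines its radius, though
  its centre only up to that radius.\<close>

lemma kball_eqD:
  assumes "kball k x r = kball k y s" "x \<in> k" "y \<in> k" "r \<in> value_group k" "s \<in> value_group k"
  shows "r = s" "vabs (x - y) \<le> r"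
proof -
  have *: "r \<le> s \<and> vabs (x - y) \<le> s"
    if "kball k x r = kball k y s" "x \<in> k" "y \<in> k" "r \<in> value_group k" "s \<in> value_group k" for x y r s
  proof -
    from that obtain a where a: "a \<in> k" "r = vabs a" by (auto simp: value_group_def)
    have "x + a \<in> kball k x r" "x \<in> kball k x r" using that(2) a by (auto simp: kball_def)
    then have "x + a \<in> kball k y s" "x \<in> kball k y s" by (simp_all only: that(1))
    then have 1: "vabs (y - (x + a)) \<le> s" "vabs (y - x) \<le> s" by (auto simp: kball_def)
    have "vabs ((y - x) - (y - (x + a))) \<le> s" by (rule vabs_diff_le[OF 1(2) 1(1)])
    then show ?thesis using a 1 by (simp add: vabs_minus_commute)
  qed
  show "r = s" using *[OF assms] *[OF assms(1)[symmetric] assms(3,2,5,4)] by linarith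
  then show "vabs (x - y) \<le> r" using *[OF assms] by simp
qed

lemma ball_lattice_mono:
  assumes "vabs (x - y) \<le> r"
  shows "ball_lattice k x r \<subseteq> ball_lattice k y r"
proof
  fix v assume v: "v \<in> ball_lattice k x r"
  then have "vabs (v $ 2) * vabs (x - y) \<le> 1 * r"
    using assms by (intro mult_mono) (auto simp: ball_lattice_def)
  then have "vabs ((v $ 1 - v $ 2 * x) + v $ 2 * (x - y)) \<le> r"
    using v by (intro vabs_add_le) (auto simp: ball_lattice_def vabs_mult)
  then show "v \<in> ball_lattice k y r"
    using v by (simp add: ball_lattice_def right_diff_distrib)
qed

lemma lat_kball:
  assumes "x \<in> k" "r \<in> value_group k"
  shows "lat k (kball k x r) = ball_lattice k x r"
proof -
  have *: "ball_lattice k y s \<subseteq> ball_lattice k x r"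
    if "kball k x r = kball k y s" "y \<in> k" "s \<in> value_group k" for y s
    using kball_eqD[OF that(1) assms(1) that(2) assms(2) that(3)] ball_lattice_mono[of y x r]
    by (simp add: vabs_minus_commute)
  show ?thesis
  proof
    show "lat k (kball k x r) \<subseteq> ball_lattice k x r"
      unfolding lat_def by (rule UN_least) (use * in auto)
    show "ball_lattice k x r \<subseteq> lat k (kball k x r)"
      unfolding lat_def using assms by (intro UN_upper[of "(x, r)", THEN order_trans[rotated]]) auto
  qed
qed

text \<open>The ball is the slice of its lattice at second coordinate 1, so lattices of this
  normalized kind determine their balls.\<close>

lemma lat_mem:
  assumes "B \<in> kballs k"
  shows "z \<in> B \<longleftrightarrow> vector [z, 1] \<in> lat k B"
proof -
  obtain x a where a: "x \<in> k" "a \<in> k" "a \<noteq> 0" "B = kball k x (vabs a)"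
    using kballs_cases[OF assms] by metis
  then have "lat k B = ball_lattice k x (vabs a)" by (simp add: lat_kball value_groupI)
  then show ?thesis using a by (auto simp: kball_def ball_lattice_def vabs_minus_commute)
qed

lemma lat_inj: "B \<in> kballs k \<Longrightarrow> B' \<in> kballs k \<Longrightarrow> lat k B = lat k B' \<Longrightarrow> B = B'"
  using lat_mem by blast

lemma ball_lattice_ospan:
  assumes "x \<in> k" "a \<in> k" "a \<noteq> 0"
  shows "ball_lattice k x (vabs a) = ospan k (vector [a, 0]) (vector [x, 1])"
proof
  show "ball_lattice k x (vabs a) \<subseteq> ospan k (vector [a, 0]) (vector [x, 1])"
  proof
    fix v assume v: "v \<in> ball_lattice k x (vabs a)"
    let ?s = "(v $ 1 - v $ 2 * x) / a"
    have "v = ?s *s vector [a, 0] + v $ 2 *s vector [x, 1]"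
      using assms by (intro vec2_eqI) auto
    moreover have "?s \<in> k" "vabs ?s \<le> 1" "v $ 2 \<in> k" "vabs (v $ 2) \<le> 1"
      using v assms by (auto simp: ball_lattice_def)
    ultimately show "v \<in> ospan k (vector [a, 0]) (vector [x, 1])"
      unfolding ospan_def by blast
  qed
  show "ospan k (vector [a, 0]) (vector [x, 1]) \<subseteq> ball_lattice k x (vabs a)"
    using assms by (auto simp: ospan_def ball_lattice_def vabs_mult mult_left_le_one_le)
qed

text \<open>With \<open>ospan_scale\<close> and \<open>ospan_commute\<close> this gives the
  elementary column operations over the valuation ring, which bring a basis to the form in
  \<open>ball_lattice_ospan\<close>.\<close>

lemma ospan_add:
  assumes "c \<in> k" "vabs c \<le> 1"
  shows "ospan k (u + c *s w) w = ospan k u w"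
proof -
  have *: "ospan k (u + c *s w) w \<subseteq> ospan k u w" if c: "c \<in> k" "vabs c \<le> 1" for u c
  proof
    fix v assume "v \<in> ospan k (u + c *s w) w"
    then obtain s t where st: "v = s *s (u + c *s w) + t *s w" "s \<in> k" "t \<in> k" "vabs s \<le> 1" "vabs t \<le> 1"
      by (auto simp: ospan_def)
    have "v = s *s u + (s * c + t) *s w"
      by (simp add: st vector_add_ldistrib vector_sadd_rdistrib vector_smult_assoc)
    moreover have "vabs (s * c + t) \<le> 1"
      using st c mult_mono[of "vabs s" 1 "vabs c" 1] by (intro vabs_add_le) (auto simp: vabs_mult)
    moreover have "s * c + t \<in> k" using st c by simp
    ultimately show "v \<in> ospan k u w" using st unfolding ospan_def by blast
  qed
  have "ospan k u w = ospan k ((u + c *s w) + (- c) *s w) w" by (simp add: vector_smult_lneg)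
  also have "\<dots> \<subseteq> ospan k (u + c *s w) w" using assms by (intro *) auto
  finally show ?thesis using *[OF assms] by blast
qed

lemma ospan_scale:
  assumes "c \<in> k" "vabs c = 1"
  shows "ospan k (c *s u) w = ospan k u w"
proof -
  have *: "ospan k (c *s u) w \<subseteq> ospan k u w" if c: "c \<in> k" "vabs c = 1" for u c
  proof
    fix v assume "v \<in> ospan k (c *s u) w"
    then obtain s t where st: "v = s *s (c *s u) + t *s w" "s \<in> k" "t \<in> k" "vabs s \<le> 1" "vabs t \<le> 1"
      by (auto simp: ospan_def)
    have "v = (s * c) *s u + t *s w" by (simp add: st vector_smult_assoc)
    moreover have "vabs (s * c) \<le> 1" "s * c \<in> k" using st c by (auto simp: vabs_mult)
    ultimately show "v \<in> ospan k u w" using st unfolding ospan_def by blast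
  qed
  have "c \<noteq> 0" using assms by auto
  then have "ospan k u w = ospan k (inverse c *s (c *s u)) w" by (simp add: vector_smult_assoc)
  also have "\<dots> \<subseteq> ospan k (c *s u) w" using assms by (intro *) auto
  finally show ?thesis using *[OF assms] by blast
qed

text \<open>Every homothety class of lattices contains the lattice of a ball. If \<open>w\<close>
  has the larger second coordinate, scaling turns \<open>w\<close> into (x, 1), and an integral
  multiple of it clears the second coordinate of \<open>u\<close>.\<close>

lemma exists_lat_ospan:
  assumes u: "u $ 1 \<in> k" "u $ 2 \<in> k" and w: "w $ 1 \<in> k" "w $ 2 \<in> k"
    and ind: "u $ 1 * w $ 2 - u $ 2 * w $ 1 \<noteq> 0"
  shows "\<exists>c B. c \<in> k \<and> c \<noteq> 0 \<and> B \<in> kballs k \<and> ospan k (c *s u) (c *s w) = lat k B"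
proof -
  have *: "\<exists>c B. c \<in> k \<and> c \<noteq> 0 \<and> B \<in> kballs k \<and> ospan k (c *s u) (c *s w) = lat k B"
    if u: "u $ 1 \<in> k" "u $ 2 \<in> k" and w: "w $ 1 \<in> k" "w $ 2 \<in> k"
    and ind: "u $ 1 * w $ 2 - u $ 2 * w $ 1 \<noteq> 0" and le: "vabs (u $ 2) \<le> vabs (w $ 2)" for u w
  proof -
    have nz: "w $ 2 \<noteq> 0" using ind le by auto
    define c where "c = inverse (w $ 2)"
    define t where "t = u $ 2 / w $ 2"
    define x where "x = w $ 1 / w $ 2"
    \<comment> \<open>The first coordinate of c u - t (x, 1): the determinant of the basis divided
      by the square of the scaling denominator.\<close>
    define a where "a = (u $ 1 * w $ 2 - u $ 2 * w $ 1) / (w $ 2)\<^sup>2"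
    have t: "t \<in> k" "vabs t \<le> 1" using u w le nz by (auto simp: t_def)
    have "c *s w = vector [x, 1]" using nz by (intro vec2_eqI) (auto simp: c_def x_def divide_inverse)
    moreover have "c *s u = vector [a, 0] + t *s vector [x, 1]"
      using nz by (intro vec2_eqI) (auto simp: c_def t_def x_def a_def field_simps power2_eq_square)
    ultimately have "ospan k (c *s u) (c *s w) = ospan k (vector [a, 0]) (vector [x, 1])"
      using ospan_add[OF t] by simp
    moreover have "x \<in> k" "a \<in> k" "a \<noteq> 0" using u w ind nz by (auto simp: x_def a_def)
    ultimately have "ospan k (c *s u) (c *s w) = lat k (kball k x (vabs a)) \<and> kball k x (vabs a) \<in> kballs k"
      by (simp add: ball_lattice_ospan lat_kball value_groupI kballs_memI)
    moreover have "c \<in> k" "c \<noteq> 0" using nz w by (auto simp: c_def)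
    ultimately show ?thesis by blast
  qed
  show ?thesis
  proof (cases "vabs (u $ 2) \<le> vabs (w $ 2)")
    case True
    then show ?thesis using * u w ind by blast
  next
    case False
    moreover have "w $ 1 * u $ 2 - w $ 2 * u $ 1 \<noteq> 0" using ind by (simp add: mult.commute)
    ultimately show ?thesis using *[OF w u] ospan_commute by (metis linear)
  qed
qed

section \<open>The action on balls through their lattices\<close>

lemma exists_lat_image:
  assumes "\<gamma> \<in> PGL2_over k" "B \<in> kballs k"
  shows "\<exists>B'\<in>kballs k. \<exists>A\<in>\<gamma>. (*v) A ` lat k B = lat k B'"
proof -
  from assms(1) obtain A where A: "\<gamma> \<in> carrier PGL2" "A \<in> \<gamma>" "matrix_over k A"
    by (auto simp: PGL2_over_def)
  obtain x a where a: "x \<in> k" "a \<in> k" "a \<noteq> 0" "B = kball k x (vabs a)"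
    using kballs_cases[OF assms(2)] by metis
  let ?u = "vector [a, 0] :: 'a^2" and ?w = "vector [x, 1] :: 'a^2"
  have L: "lat k B = ospan k ?u ?w" using a by (simp add: lat_kball value_groupI ball_lattice_ospan)
  have "(A *v ?u) $ i \<in> k" "(A *v ?w) $ i \<in> k" for i
    using A(3) a by (auto simp: matrix_vec2 matrix_over_def)
  moreover have "(A *v ?u) $ 1 * (A *v ?w) $ 2 - (A *v ?u) $ 2 * (A *v ?w) $ 1 \<noteq> 0"
    using a by (intro independent_image PGL2_invertible[OF A(1,2)]) auto
  ultimately obtain c B' where c: "c \<in> k" "c \<noteq> 0" "B' \<in> kballs k"
    "ospan k (c *s (A *v ?u)) (c *s (A *v ?w)) = lat k B'"
    using exists_lat_ospan by metis
  have "(*v) (mat c ** A) ` lat k B = lat k B'"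
    unfolding L image_ospan mat_mult_vec_scale by (rule c)
  then show ?thesis using c(3) PGL2_mem_scale[OF A(1,2) c(2)] by blast
qed

lemma lat_scale:
  assumes "B \<in> kballs k" "c \<in> k" "vabs c = 1"
  shows "(*s) c ` lat k B = lat k B"
proof -
  obtain x a where a: "x \<in> k" "a \<in> k" "a \<noteq> 0" "B = kball k x (vabs a)"
    using kballs_cases[OF assms(1)] by metis
  then have L: "lat k B = ospan k (vector [a, 0]) (vector [x, 1])"
    by (simp add: lat_kball value_groupI ball_lattice_ospan)
  have "(*s) c ` lat k B = (*v) (mat c) ` lat k B" by (simp add: mat_mult_vec)
  also have "\<dots> = lat k B"
    unfolding L image_ospan mat_mult_vec ospan_scale[OF assms(2,3)]
    by (subst (1 2) ospan_commute) (rule ospan_scale[OF assms(2,3)])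
  finally show ?thesis .
qed

text \<open>A ball lattice contains a vector with second coordinate 1, and second coordinates in it
  never exceed 1 in absolute value. Applied to a homothety and its inverse, this shows that the
  factor is a unit.\<close>

lemma lat_scale_unit:
  assumes "B \<in> kballs k" "B' \<in> kballs k" "(*s) c ` lat k B = lat k B'"
  shows "c \<in> k" "vabs c \<le> 1"
proof -
  obtain x a where a: "x \<in> k" "a \<in> k" "a \<noteq> 0" "B = kball k x (vabs a)"
    using kballs_cases[OF assms(1)] by metis
  obtain y b where b: "y \<in> k" "b \<in> k" "b \<noteq> 0" "B' = kball k y (vabs b)"
    using kballs_cases[OF assms(2)] by metis
  have "vector [x, 1] \<in> lat k B" using a by (simp add: lat_kball value_groupI ball_lattice_def)
  then have "c *s vector [x, 1] \<in> lat k B'" using assms(3) by blast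
  then show "c \<in> k" "vabs c \<le> 1"
    using b by (auto simp: lat_kball value_groupI ball_lattice_def)
qed

text \<open>This is why \<open>bt_act\<close> is well defined: two representatives of
  \<open>\<gamma>\<close> differ by a scalar, and a scalar between two ball lattices is a unit,
  which preserves each of them.\<close>

lemma lat_image_unique:
  assumes "\<gamma> \<in> carrier PGL2" "A \<in> \<gamma>" "A' \<in> \<gamma>"
    and "B \<in> kballs k" "B' \<in> kballs k"
    and "(*v) A ` L = lat k B" "(*v) A' ` L = lat k B'"
  shows "B = B'"
proof -
  obtain c where c: "c \<noteq> 0" "A' = mat c ** A" using PGL2_mem_unique[OF assms(1-3)] by metis
  have L': "(*s) c ` lat k B = lat k B'"
    using assms(6,7) unfolding c(2) mat_mult_vec_scale by (auto simp: image_image[symmetric])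
  have "(*s) (inverse c) ` (*s) c ` lat k B = lat k B"
    using c(1) by (simp add: image_image vector_smult_assoc)
  then have L: "(*s) (inverse c) ` lat k B' = lat k B" unfolding L' .
  have "vabs c \<le> 1" "vabs (inverse c) \<le> 1" "c \<in> k"
    using lat_scale_unit assms(4,5) L L' by blast+
  then have "vabs c = 1" using c(1) by (simp add: field_simps)
  then have "lat k B' = lat k B" using lat_scale[OF assms(4) \<open>c \<in> k\<close>] L' by simp
  then show ?thesis using lat_inj assms by metis
qed

text \<open>The description by \<open>THE\<close> is evaluated only here; all further facts on the
  action come down to images of lattices.\<close>

lemma bt_act_eqI:
  assumes "\<gamma> \<in> carrier PGL2" "A \<in> \<gamma>" "B \<in> kballs k" "B' \<in> kballs k"
    and "(*v) A ` lat k B = lat k B'"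
  shows "bt_act k \<gamma> B = B'"
  unfolding bt_act_def
proof (rule the_equality)
  show "\<exists>x r x' r'. x \<in> k \<and> r \<in> value_group k \<and> B = kball k x r \<and>
     x' \<in> k \<and> r' \<in> value_group k \<and> B' = kball k x' r' \<and>
     (\<exists>A\<in>\<gamma>. (*v) A ` ball_lattice k x r = ball_lattice k x' r')"
  proof -
    obtain x r where x: "x \<in> k" "r \<in> value_group k" "B = kball k x r"
      using assms(3) by (auto simp: kballs_def)
    obtain x' r' where x': "x' \<in> k" "r' \<in> value_group k" "B' = kball k x' r'"
      using assms(4) by (auto simp: kballs_def)
    have "(*v) A ` ball_lattice k x r = ball_lattice k x' r'"
      using assms(5) x x' by (simp add: lat_kball)
    then show ?thesis using x x' assms(2) by blast
  qed
  fix C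
  assume "\<exists>x r x' r'. x \<in> k \<and> r \<in> value_group k \<and> B = kball k x r \<and>
     x' \<in> k \<and> r' \<in> value_group k \<and> C = kball k x' r' \<and>
     (\<exists>A\<in>\<gamma>. (*v) A ` ball_lattice k x r = ball_lattice k x' r')"
  then obtain A' where "A' \<in> \<gamma>" "C \<in> kballs k" "(*v) A' ` lat k B = lat k C"
    by (auto simp: lat_kball kballs_memI)
  then show "C = B'" using lat_image_unique assms by metis
qed

lemma bt_act_lat:
  assumes "\<gamma> \<in> PGL2_over k" "B \<in> kballs k"
  shows "bt_act k \<gamma> B \<in> kballs k" "\<exists>A\<in>\<gamma>. (*v) A ` lat k B = lat k (bt_act k \<gamma> B)"
proof -
  obtain B' A where A: "B' \<in> kballs k" "A \<in> \<gamma>" "(*v) A ` lat k B = lat k B'"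
    using exists_lat_image[OF assms] by blast
  then have "bt_act k \<gamma> B = B'" using bt_act_eqI assms by (auto simp: PGL2_over_def)
  then show "bt_act k \<gamma> B \<in> kballs k" "\<exists>A\<in>\<gamma>. (*v) A ` lat k B = lat k (bt_act k \<gamma> B)"
    using A by auto
qed

lemma bt_act_one: "B \<in> kballs k \<Longrightarrow> bt_act k \<one>\<^bsub>PGL2\<^esub> B = B"
proof -
  interpret P: Group.group "PGL2 :: ('a^2^2) set monoid" by (rule group_PGL2)
  show "B \<in> kballs k \<Longrightarrow> bt_act k \<one>\<^bsub>PGL2\<^esub> B = B"
    by (rule bt_act_eqI[OF _ mem_one_PGL2]) auto
qed

lemma bt_act_mult:
  assumes "\<gamma> \<in> PGL2_over k" "\<delta> \<in> PGL2_over k" "B \<in> kballs k"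
  shows "bt_act k (\<gamma> \<otimes>\<^bsub>PGL2\<^esub> \<delta>) B = bt_act k \<gamma> (bt_act k \<delta> B)"
proof -
  interpret P: Group.group "PGL2 :: ('a^2^2) set monoid" by (rule group_PGL2)
  obtain D where D: "D \<in> \<delta>" "(*v) D ` lat k B = lat k (bt_act k \<delta> B)"
    using bt_act_lat(2)[OF assms(2,3)] by blast
  note B' = bt_act_lat(1)[OF assms(2,3)]
  obtain A where A: "A \<in> \<gamma>" "(*v) A ` lat k (bt_act k \<delta> B) = lat k (bt_act k \<gamma> (bt_act k \<delta> B))"
    using bt_act_lat(2)[OF assms(1) B'] by blast
  show ?thesis
  proof (rule bt_act_eqI[OF _ mem_mult_PGL2[OF A(1) D(1)] assms(3)])
    show "\<gamma> \<otimes>\<^bsub>PGL2\<^esub> \<delta> \<in> carrier PGL2" using assms by (simp add: PGL2_over_def)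
    show "bt_act k \<gamma> (bt_act k \<delta> B) \<in> kballs k" by (rule bt_act_lat(1)[OF assms(1) B'])
    show "(*v) (A ** D) ` lat k B = lat k (bt_act k \<gamma> (bt_act k \<delta> B))"
      using A(2) unfolding D(2)[symmetric] by (simp add: image_image matrix_vector_mul_assoc)
  qed
qed

text \<open>The basis (a, 0), (x, 1) is orthonormal: the gauge of s (a, 0) + t (x, 1) is the maximum
  of |s| and |t|, even for s and t outside \<open>k\<close>. So a bound on the images of the two
  basis vectors extends to the whole plane.\<close>

lemma ball_gauge_le_of_lat_image:
  assumes "x \<in> k" "a \<in> k" "a \<noteq> 0"
    and "(*v) A ` ball_lattice k x (vabs a) \<subseteq> ball_lattice k x (vabs a)"
  shows "ball_gauge x (vabs a) (A *v v) \<le> ball_gauge x (vabs a) v"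
proof -
  let ?g = "ball_gauge x (vabs a)"
  let ?u = "vector [a, 0] :: 'a^2" and ?w = "vector [x, 1] :: 'a^2"
  have r: "vabs a > 0" using assms by simp
  have "?u \<in> ball_lattice k x (vabs a)" "?w \<in> ball_lattice k x (vabs a)"
    using assms by (auto simp: ball_lattice_def)
  then have 1: "?g (A *v ?u) \<le> 1" "?g (A *v ?w) \<le> 1"
    using assms(4) by (auto simp: ball_lattice_ball_gauge[OF r] image_subset_iff)
  define s where "s = (v $ 1 - v $ 2 * x) / a"
  define t where "t = v $ 2"
  have v: "v = s *s ?u + t *s ?w"
    using assms by (intro vec2_eqI) (auto simp: s_def t_def)
  have st: "vabs s \<le> ?g v" "vabs t \<le> ?g v" by (auto simp: s_def t_def ball_gauge_def)
  have "A *v v = s *s (A *v ?u) + t *s (A *v ?w)"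
    unfolding v by (simp add: matrix_vector_right_distrib matrix_vec_scale)
  moreover have "?g (s *s (A *v ?u)) \<le> ?g v"
    using mult_mono[OF st(1) 1(1) ball_gauge_nonneg ball_gauge_nonneg]
    by (simp add: ball_gauge_scale[OF r])
  moreover have "?g (t *s (A *v ?w)) \<le> ?g v"
    using mult_mono[OF st(2) 1(2) ball_gauge_nonneg ball_gauge_nonneg]
    by (simp add: ball_gauge_scale[OF r])
  ultimately show ?thesis using ball_gauge_add_le[OF r] by simp
qed

lemma ball_gauge_isometry:
  assumes "x \<in> k" "a \<in> k" "a \<noteq> 0" "invertible A"
    and "(*v) A ` ball_lattice k x (vabs a) = ball_lattice k x (vabs a)"
  shows "ball_gauge x (vabs a) (A *v v) = ball_gauge x (vabs a) v"
proof (rule antisym)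
  let ?L = "ball_lattice k x (vabs a)"
  show "ball_gauge x (vabs a) (A *v v) \<le> ball_gauge x (vabs a) v"
    using assms by (intro ball_gauge_le_of_lat_image) auto
  obtain B where B: "B ** A = mat 1" using assms(4) by (auto simp: invertible_def)
  then have BA: "B *v (A *v u) = u" for u by (simp add: matrix_vector_mul_assoc)
  have "(*v) B ` ((*v) A ` ?L) = ?L" by (simp add: image_image BA)
  then have "(*v) B ` ?L = ?L" using assms(5) by simp
  then have "ball_gauge x (vabs a) (B *v (A *v v)) \<le> ball_gauge x (vabs a) (A *v v)"
    using assms by (intro ball_gauge_le_of_lat_image) auto
  then show "ball_gauge x (vabs a) v \<le> ball_gauge x (vabs a) (A *v v)" by (simp add: BA)
qed

lemma vertex_stabilizer_finite_order:
  assumes "discontinuous G" "G \<subseteq> PGL2_over k" "\<gamma> \<in> G" "B \<in> kballs k" "bt_act k \<gamma> B = B"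
  shows "\<exists>n>0. \<gamma> [^]\<^bsub>PGL2\<^esub> (n::nat) = \<one>\<^bsub>PGL2\<^esub>"
proof -
  have \<gamma>: "\<gamma> \<in> PGL2_over k" using assms by blast
  obtain A where A: "A \<in> \<gamma>" "(*v) A ` lat k B = lat k B"
    using bt_act_lat(2)[OF \<gamma> assms(4)] assms(5) by auto
  obtain x a where a: "x \<in> k" "a \<in> k" "a \<noteq> 0" "B = kball k x (vabs a)"
    using kballs_cases[OF assms(4)] by metis
  show ?thesis
  proof (rule isometry_finite_order[OF assms(1,3) A(1), of "vabs a" x])
    have "invertible A" using PGL2_invertible A(1) \<gamma> by (auto simp: PGL2_over_def)
    then show "ball_gauge x (vabs a) (A *v v) = ball_gauge x (vabs a) v" for v
      using ball_gauge_isometry[of x a A v] A a by (simp add: lat_kball value_groupI)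
  qed (use a in simp)
qed

text \<open>After division by \<open>b\<close> the representative acts on the basis with factors a/b
  and 1, both units of the valuation ring.\<close>

lemma bt_act_eigenbasis:
  assumes \<gamma>: "\<gamma> \<in> carrier PGL2" "A \<in> \<gamma>"
    and B: "B \<in> kballs k" "lat k B = ospan k u w"
    and A: "A *v u = a *s u" "A *v w = b *s w" "a \<in> k" "b \<in> k" "vabs a = vabs b" "b \<noteq> 0"
  shows "bt_act k \<gamma> B = B"
proof (rule bt_act_eqI[OF \<gamma>(1) _ B(1,1)])
  show "mat (inverse b) ** A \<in> \<gamma>" using PGL2_mem_scale[OF \<gamma>] A by simp
  have "ospan k ((inverse b * a) *s u) ((inverse b * b) *s w) = ospan k u w"
    using A by (simp add: ospan_scale vabs_mult)
  then show "(*v) (mat (inverse b) ** A) ` lat k B = lat k B"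
    unfolding B image_ospan mat_mult_vec_scale by (simp add: A vector_smult_assoc)
qed

end

section \<open>Elements of finite order\<close>

lemma exists_square_root_alg:
  fixes A :: "'a::complete_valued_field set"
  assumes "algebraic_closure (ring_of_type_algebra\<lparr>carrier := A\<rparr>) K" "a \<in> A"
  shows "\<exists>s\<in>A. s * s = a"
proof -
  define L where "L = (ring_of_type_algebra\<lparr>carrier := A\<rparr> :: 'a ring)"
  interpret algebraic_closure L K using assms(1) by (simp add: L_def)
  have [simp]: "carrier L = A" "\<one>\<^bsub>L\<^esub> = 1" "\<zero>\<^bsub>L\<^esub> = 0" "x \<otimes>\<^bsub>L\<^esub> y = x * y" "x \<oplus>\<^bsub>L\<^esub> y = x + y" for x y
    by (simp_all add: L_def ring_of_type_algebra_def)
  \<comment> \<open>Coefficients are listed from the leading one, so this is the polynomial X^2 - a.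
    It splits, hence it has a root.\<close>
  define P where "P = [\<one>\<^bsub>L\<^esub>, \<zero>\<^bsub>L\<^esub>, \<ominus>\<^bsub>L\<^esub> a]"
  have aL: "a \<in> carrier L" using assms(2) by simp
  have "1 \<in> A" "0 \<in> A" "\<ominus>\<^bsub>L\<^esub> a \<in> A"
    using monoid.one_closed[OF ring.is_monoid[OF ring_axioms]] zero_closed a_inv_closed[OF aL] by simp_all
  then have "set P \<subseteq> carrier L" by (simp add: P_def)
  then have P: "P \<in> carrier (poly_ring L)"
    by (simp add: univ_poly_def polynomial_def P_def)
  then have "splitted P" by (rule roots_over_carrier)
  then have "size (roots P) = 2" by (simp add: splitted_def P_def)
  then obtain x where "x \<in># roots P" by (metis multiset_nonemptyE size_empty zero_neq_numeral)
  then have x: "is_root P x" using roots_mem_iff_is_root[OF P] by auto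
  then have xL: "x \<in> carrier L" by (simp add: is_root_def)
  have "x \<otimes>\<^bsub>L\<^esub> x \<oplus>\<^bsub>L\<^esub> \<ominus>\<^bsub>L\<^esub> a = \<zero>\<^bsub>L\<^esub>"
    using x xL by (simp add: is_root_def P_def power2_eq_square numeral_2_eq_2)
  then have "x \<otimes>\<^bsub>L\<^esub> x = a"
    using r_right_minus_eq[of "x \<otimes>\<^bsub>L\<^esub> x" a] xL aL unfolding a_minus_def by blast
  then show ?thesis using xL by auto
qed

text \<open>The estimate comes from s^2 - l^2 = (s - l) ((s - l) + 2 l).\<close>

lemma tendsto_square:
  fixes s :: "nat \<Rightarrow> 'a::complete_valued_field"
  assumes "s \<longlonglongrightarrow> l"
  shows "(\<lambda>n. s n * s n) \<longlonglongrightarrow> l * l"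
  unfolding tendsto_dist_iff[of _ "l * l"]
proof (rule tendsto_sandwich[of "\<lambda>_. 0" _ _ "\<lambda>n. dist (s n) l * (dist (s n) l + vabs (2 * l))"])
  have 0: "(\<lambda>n. dist (s n) l) \<longlonglongrightarrow> 0" using assms by (rule iffD1[OF tendsto_dist_iff])
  then show "(\<lambda>n. dist (s n) l * (dist (s n) l + vabs (2 * l))) \<longlonglongrightarrow> 0"
    using tendsto_mult[OF 0 tendsto_add[OF 0 tendsto_const[of "vabs (2 * l)"]]] by simp
  show "\<forall>\<^sub>F n in sequentially. dist (s n * s n) (l * l) \<le> dist (s n) l * (dist (s n) l + vabs (2 * l))"
  proof (rule always_eventually, rule allI)
    fix n
    have "dist (s n * s n) (l * l) = vabs (s n - l) * vabs ((s n - l) + 2 * l)"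
      by (simp add: dist_vabs vabs_mult[symmetric] algebra_simps)
    also have "\<dots> \<le> vabs (s n - l) * (vabs (s n - l) + vabs (2 * l))"
      using vabs_add_le_max[of "s n - l" "2 * l"] vabs_nonneg[of "s n - l"] vabs_nonneg[of "2 * l"]
      by (intro mult_left_mono) linarith+
    finally show "dist (s n * s n) (l * l) \<le> dist (s n) l * (dist (s n) l + vabs (2 * l))"
      by (simp add: dist_vabs)
  qed
qed auto

text \<open>In an ultrametric space, small consecutive steps already give a Cauchy sequence. The
  square in the hypothesis is the bound obtained for the nearer of the two square roots.\<close>

lemma Cauchy_of_steps:
  fixes s d :: "nat \<Rightarrow> 'a::complete_valued_field"
  assumes "Cauchy d" and step: "\<And>n. (vabs (s (Suc n) - s n))\<^sup>2 \<le> vabs (d (Suc n) - d n)"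
  shows "Cauchy s"
  unfolding Cauchy_altdef2
proof (intro allI impI)
  fix e :: real assume e: "e > 0"
  then obtain N where N: "\<And>m n. m \<ge> N \<Longrightarrow> n \<ge> N \<Longrightarrow> dist (d m) (d n) < e\<^sup>2"
    using assms(1) unfolding Cauchy_def by (meson zero_less_power)
  have "dist (s n) (s N) < e" if "n \<ge> N" for n
    using that
  proof (induction n rule: dec_induct)
    case (step n)
    have "(vabs (s (Suc n) - s n))\<^sup>2 < e\<^sup>2"
      using assms(2)[of n] N[of "Suc n" n] step(1) by (simp add: dist_vabs)
    then have "vabs (s (Suc n) - s n) < e" using e by (simp add: power_less_imp_less_base)
    then have "vabs ((s (Suc n) - s n) + (s n - s N)) < e"
      using step(3) by (intro vabs_add_less) (auto simp: dist_vabs)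
    then show ?case by (simp add: dist_vabs)
  qed (use e in simp)
  then show "\<exists>N. \<forall>n\<ge>N. dist (s n) (s N) < e" by blast
qed

text \<open>
  If the square roots of the members of a sequence in \<open>A\<close> are chosen with the right signs, they form
  a Cauchy sequence.
\<close>
lemma exists_square_root:
  fixes d :: "'a::complete_valued_field"
  assumes "is_Cp p TYPE('a)"
  shows "\<exists>s. s * s = d"
proof -
  obtain A :: "'a set" where A: "algebraic_closure (ring_of_type_algebra\<lparr>carrier := A\<rparr>) Qp" "closure A = UNIV"
    using assms by (auto simp: is_Cp_def)
  obtain f where f: "\<And>n. f n \<in> A" "f \<longlonglongrightarrow> d"
    using closure_sequential[of d A] A(2) by auto
  have "\<exists>s :: nat \<Rightarrow> 'a. \<forall>n. (s n * s n = f n) \<and> (vabs (s (Suc n) - s n))\<^sup>2 \<le> vabs (f (Suc n) - f n)"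
  proof (rule dependent_nat_choice)
    show "\<exists>s. s * s = f 0" using exists_square_root_alg[OF A(1) f(1)] by blast
    fix s n assume s: "s * s = f n"
    obtain t where t: "t * t = f (Suc n)" using exists_square_root_alg[OF A(1) f(1)] by blast
    \<comment> \<open>The distances of the candidates t and -t from s multiply to |f (n+1) - f n|,
      so the square of the smaller one is at most this value.\<close>
    have eq: "vabs (t - s) * vabs (- t - s) = vabs (f (Suc n) - f n)"
    proof -
      have "(t - s) * (- t - s) = - (f (Suc n) - f n)"
        by (simp add: s[symmetric] t[symmetric] algebra_simps)
      then show ?thesis by (metis vabs_mult vabs_uminus)
    qed
    show "\<exists>s'. s' * s' = f (Suc n) \<and> (vabs (s' - s))\<^sup>2 \<le> vabs (f (Suc n) - f n)"
    proof (cases "vabs (t - s) \<le> vabs (- t - s)")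
      case True
      then have "(vabs (t - s))\<^sup>2 \<le> vabs (f (Suc n) - f n)"
        unfolding power2_eq_square eq[symmetric] by (intro mult_left_mono) auto
      then show ?thesis using t by blast
    next
      case False
      then have "(vabs (- t - s))\<^sup>2 \<le> vabs (f (Suc n) - f n)"
        unfolding power2_eq_square eq[symmetric] by (intro mult_right_mono) auto
      then show ?thesis using t by (intro exI[of _ "- t"]) simp
    qed
  qed
  then obtain s where s: "\<And>n. s n * s n = f n"
    "\<And>n. (vabs (s (Suc n) - s n))\<^sup>2 \<le> vabs (f (Suc n) - f n)" by blast
  have "Cauchy s"
    using Cauchy_of_steps[of f s] s(2) LIMSEQ_imp_Cauchy[OF f(2)] by blast
  then obtain l where "s \<longlonglongrightarrow> l" using Cauchy_convergent convergent_def by blast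
  then have "f \<longlonglongrightarrow> l * l" using tendsto_square[of s l] by (simp add: s(1))
  then show ?thesis using f(2) LIMSEQ_unique by blast
qed

text \<open>The hypothesis is the characteristic equation for \<open>l\<close>. A kernel vector of A
  - l is read off from the first row, from the second row, or from the diagonal form, according to
  which off-diagonal entry is nonzero.\<close>

lemma exists_eigenvector:
  fixes A :: "'a::field^2^2"
  assumes "(A $ 1 $ 1 - l) * (A $ 2 $ 2 - l) = A $ 1 $ 2 * A $ 2 $ 1"
  shows "\<exists>v. v \<noteq> 0 \<and> A *v v = l *s v"
proof -
  consider "A $ 1 $ 2 \<noteq> 0" | "A $ 2 $ 1 \<noteq> 0" | "A $ 1 $ 2 = 0" "A $ 2 $ 1 = 0" by blast
  then show ?thesis
  proof cases
    case 1
    let ?v = "vector [A $ 1 $ 2, l - A $ 1 $ 1] :: 'a^2"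
    have "?v \<noteq> 0" using 1 by (auto simp: vec_eq_iff forall_2)
    moreover have "A *v ?v = l *s ?v"
      using assms by (intro vec2_eqI) (auto simp: matrix_vec2 algebra_simps)
    ultimately show ?thesis by blast
  next
    case 2
    let ?v = "vector [l - A $ 2 $ 2, A $ 2 $ 1] :: 'a^2"
    have "?v \<noteq> 0" using 2 by (auto simp: vec_eq_iff forall_2)
    moreover have "A *v ?v = l *s ?v"
      using assms by (intro vec2_eqI) (auto simp: matrix_vec2 algebra_simps)
    ultimately show ?thesis by blast
  next
    case 3
    then have "A $ 1 $ 1 = l \<or> A $ 2 $ 2 = l" using assms by auto
    then show ?thesis
    proof
      assume "A $ 1 $ 1 = l"
      then show ?thesis using 3
        by (intro exI[of _ "vector [1, 0]"]) (auto simp: vec_eq_iff forall_2 matrix_vec2)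
    next
      assume "A $ 2 $ 2 = l"
      then show ?thesis using 3
        by (intro exI[of _ "vector [0, 1]"]) (auto simp: vec_eq_iff forall_2 matrix_vec2)
    qed
  qed
qed

lemma eigenvector_funpow:
  fixes A :: "'a::field^2^2"
  assumes "A *v v = l *s v"
  shows "((*v) A ^^ n) v = l ^ n *s v"
  by (induction n) (simp_all add: assms matrix_vec_scale vector_smult_assoc mult.commute)

text \<open>The hypothesis says N^2 = 0 for N = A - l, whence A^n = l^n + n l^(n-1) N. The extra
  factor \<open>l\<close> avoids the exponent n - 1.\<close>

lemma unipotent_funpow:
  fixes A :: "'a::field^2^2"
  assumes N: "\<And>u. A *v (A *v u - l *s u) = l *s (A *v u - l *s u)"
  shows "l *s ((*v) A ^^ n) u = l ^ Suc n *s u + (of_nat n * l ^ n) *s (A *v u - l *s u)"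
proof (induction n)
  case (Suc n)
  let ?N = "A *v u - l *s u"
  have "l *s ((*v) A ^^ Suc n) u = A *v (l *s ((*v) A ^^ n) u)" by (simp add: matrix_vec_scale)
  also have "\<dots> = l ^ Suc n *s (A *v u) + (of_nat n * l ^ n) *s (l *s ?N)"
    unfolding Suc by (simp only: matrix_vector_right_distrib matrix_vec_scale N)
  also have "l ^ Suc n *s (A *v u) = l ^ Suc (Suc n) *s u + l ^ Suc n *s ?N"
    by (simp add: vector_ssub_ldistrib vector_smult_assoc mult_ac)
  also have "l ^ Suc (Suc n) *s u + l ^ Suc n *s ?N + (of_nat n * l ^ n) *s (l *s ?N)
      = l ^ Suc (Suc n) *s u + (l ^ Suc n + of_nat n * l ^ n * l) *s ?N"
    by (simp only: vector_smult_assoc vector_sadd_rdistrib add.assoc)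
  also have "l ^ Suc n + of_nat n * l ^ n * l = of_nat (Suc n) * l ^ Suc n"
    by (simp add: algebra_simps)
  finally show ?case .
qed simp

text \<open>If A^n is the scalar c, each eigenvalue is an n-th root of c, so distinct eigenvalues
  have equal absolute value. For a double eigenvalue l, the expansion above forces n l^n N = 0, and
  in characteristic 0 this leaves only scalar matrices.\<close>

lemma finite_order_elliptic:
  fixes \<gamma> :: "('a::complete_valued_field^2^2) set"
  assumes Cp: "is_Cp p TYPE('a)" and \<gamma>: "\<gamma> \<in> carrier PGL2" "\<gamma> \<noteq> \<one>\<^bsub>PGL2\<^esub>"
    and n: "n > 0" "\<gamma> [^]\<^bsub>PGL2\<^esub> (n::nat) = \<one>\<^bsub>PGL2\<^esub>"
  shows "elliptic \<gamma>"
proof -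
  interpret P: Group.group "PGL2 :: ('a^2^2) set monoid" by (rule group_PGL2)
  obtain A where A: "A \<in> \<gamma>" using PGL2_nonempty[OF \<gamma>(1)] by blast
  obtain B where "B \<in> scalars" and B: "\<And>v. B *v v = ((*v) A ^^ n) v"
    using mem_pow_PGL2[OF A, of n] n(2) by (auto simp: one_PGL2)
  then obtain c where "B = mat c" "c \<noteq> 0" by (auto simp: scalars_def)
  then have c: "((*v) A ^^ n) v = c *s v" for v using B[of v] by (simp add: mat_mult_vec)
  have ev: "l ^ n = c" if "A *v v = l *s v" "v \<noteq> 0" for v l
    using eigenvector_funpow[OF that(1), of n] c[of v] that(2) by simp
  define t where "t = A $ 1 $ 1 + A $ 2 $ 2"
  \<comment> \<open>A square root of the discriminant of the characteristic polynomial; the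
    eigenvalues are (t + s)/2 and (t - s)/2.\<close>
  obtain s where s: "s * s = (A $ 1 $ 1 - A $ 2 $ 2)\<^sup>2 + 4 * A $ 1 $ 2 * A $ 2 $ 1"
    using exists_square_root[OF Cp] by blast
  have root: "(A $ 1 $ 1 - (t + e) / 2) * (A $ 2 $ 2 - (t + e) / 2) = A $ 1 $ 2 * A $ 2 $ 1"
    if "e * e = s * s" for e
  proof -
    have "(A $ 1 $ 1 - (t + e) / 2) * (A $ 2 $ 2 - (t + e) / 2) = (e * e - (A $ 1 $ 1 - A $ 2 $ 2)\<^sup>2) / 4"
      by (simp add: t_def field_simps power2_eq_square)
    then show ?thesis using s that by simp
  qed
  obtain v where v: "v \<noteq> 0" "A *v v = ((t + s) / 2) *s v"
    using exists_eigenvector[OF root[of s]] by blast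
  obtain w where w: "w \<noteq> 0" "A *v w = ((t - s) / 2) *s w"
    using exists_eigenvector[OF root[of "- s"]] by auto
  show ?thesis
  proof (cases "s = 0")
    case False
    have "vabs ((t + s) / 2) ^ n = vabs ((t - s) / 2) ^ n"
      unfolding vabs_power[symmetric] using ev v w by simp
    then have "vabs ((t + s) / 2) = vabs ((t - s) / 2)"
      by (rule power_eq_imp_eq_base[OF _ vabs_nonneg vabs_nonneg n(1)])
    moreover have "(t + s) / 2 \<noteq> (t - s) / 2" using False by (simp add: field_simps)
    ultimately show ?thesis using v w A unfolding elliptic_def by blast
  next
    case True
    define l where "l = t / 2"
    have v': "A *v v = l *s v" using v True by (simp add: l_def)
    have l: "l ^ n = c" using ev[OF v' v(1)] .
    then have l0: "l \<noteq> 0" using \<open>c \<noteq> 0\<close> n(1) by (auto simp: power_0_left)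
    \<comment> \<open>Cayley-Hamilton for a double eigenvalue: trace 2 l and vanishing discriminant
      give (A - l)^2 = 0.\<close>
    have N: "A *v (A *v u - l *s u) = l *s (A *v u - l *s u)" for u
    proof -
      have l2: "A $ 2 $ 2 = 2 * l - A $ 1 $ 1" 
      proof -
        have "2 * l = t" by (simp add: l_def)
        then show ?thesis by (simp add: t_def)
      qed
      have bc: "A $ 1 $ 2 * A $ 2 $ 1 = - (l - A $ 1 $ 1)\<^sup>2"
      proof -
        have "4 * (A $ 1 $ 2 * A $ 2 $ 1) = - (A $ 1 $ 1 - A $ 2 $ 2)\<^sup>2"
          using s True by (simp add: eq_neg_iff_add_eq_0 add.commute mult.assoc)
        also have "\<dots> = 4 * (- (l - A $ 1 $ 1)\<^sup>2)"
          unfolding l2 by (simp add: power2_eq_square algebra_simps)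
        finally show ?thesis by simp
      qed
      show ?thesis
      proof (rule vec2_eqI)
        have "(A *v (A *v u - l *s u)) $ 1 - (l *s (A *v u - l *s u)) $ 1
            = (A $ 1 $ 2 * A $ 2 $ 1 + (l - A $ 1 $ 1)\<^sup>2) * u $ 1"
          by (simp add: matrix_vec2 l2 power2_eq_square algebra_simps)
        then show "(A *v (A *v u - l *s u)) $ 1 = (l *s (A *v u - l *s u)) $ 1" by (simp add: bc)
        have "(A *v (A *v u - l *s u)) $ 2 - (l *s (A *v u - l *s u)) $ 2
            = (A $ 1 $ 2 * A $ 2 $ 1 + (l - A $ 1 $ 1)\<^sup>2) * u $ 2"
          by (simp add: matrix_vec2 l2 power2_eq_square algebra_simps)
        then show "(A *v (A *v u - l *s u)) $ 2 = (l *s (A *v u - l *s u)) $ 2" by (simp add: bc)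
      qed
    qed
    have "A *v u = l *s u" for u
    proof -
      have "(l * c) *s u = (l * c) *s u + (of_nat n * l ^ n) *s (A *v u - l *s u)"
        using unipotent_funpow[OF N, of n u] by (simp add: c l vector_smult_assoc)
      then have "(of_nat n * l ^ n) *s (A *v u - l *s u) = 0" by simp
      moreover have "of_nat n * l ^ n \<noteq> 0" using n(1) l0 by simp
      ultimately have "A *v u - l *s u = 0" unfolding vector_mul_eq_0 by blast
      then show ?thesis by simp
    qed
    then have "A = mat l" unfolding matrix_eq by (simp add: mat_mult_vec)
    then have "A \<in> \<one>\<^bsub>PGL2\<^esub>" using l0 by (auto simp: one_PGL2 scalars_def)
    then have "\<gamma> = \<one>\<^bsub>PGL2\<^esub>" using PGL2_eqI[OF \<gamma>(1) _ A] by simp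
    then show ?thesis using \<gamma>(2) by simp
  qed
qed

section \<open>Paths between fixed points\<close>

text \<open>A nontrivial discrete subgroup of the positive reals is generated by its least element
  above 1. Isolation of the value 1 becomes, by division, a uniform relative gap 1 + e between
  different values.\<close>

lemma (in subfield_set) value_group_powers:
  assumes "discrete (value_group k)" "a \<in> k" "a \<noteq> 0" "vabs a \<noteq> 1"
  shows "\<exists>q>1. value_group k = range (\<lambda>i::int. q powi i)"
proof -
  let ?V = "value_group k"
  have V1: "1 \<in> ?V" using value_groupI[OF one] by simp
  have Vd: "v / w \<in> ?V" if "v \<in> ?V" "w \<in> ?V" for v w
  proof -
    from that obtain b c where "b \<in> k" "c \<in> k" "b \<noteq> 0" "c \<noteq> 0" "v = vabs b" "w = vabs c"
      by (auto simp: value_group_def)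
    then show ?thesis using value_groupI[of "b / c"] by simp
  qed
  have Vm: "v * w \<in> ?V" if "v \<in> ?V" "w \<in> ?V" for v w
    using Vd[OF that(1) Vd[OF V1 that(2)]] by simp
  have Vpow: "v ^ n \<in> ?V" if "v \<in> ?V" for v and n :: nat
    by (induction n) (use that V1 Vm in auto)
  have Vpowi: "v powi i \<in> ?V" if "v \<in> ?V" for v i
    using Vpow[OF that] Vd[OF V1 Vpow[OF that]] by (auto simp: power_int_def divide_inverse power_inverse)
  obtain e where e: "e > 0" "\<And>v. v \<in> ?V \<Longrightarrow> dist 1 v < e \<Longrightarrow> v = 1"
    using discreteD[OF assms(1) V1] unfolding isolated_in_dist_Ex_iff by (metis dist_commute)
  have gap: "w \<ge> v * (1 + e)" if "v \<in> ?V" "w \<in> ?V" "v < w" for v w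
  proof -
    have v: "v > 0" using that(1) by (rule value_group_pos)
    have "\<not> dist 1 (w / v) < e" using e(2)[OF Vd[OF that(2,1)]] that(3) v by auto
    moreover have "w / v > 1" using v that(3) by simp
    ultimately have "w / v \<ge> 1 + e" by (simp add: dist_real_def)
    then show ?thesis using v by (simp add: pos_le_divide_eq mult.commute)
  qed
  define W where "W = {v \<in> ?V. v > 1}"
  have av: "vabs a \<in> ?V" using assms by (intro value_groupI)
  have "W \<noteq> {}"
  proof (cases "vabs a > 1")
    case False
    then have "1 / vabs a > 1" using assms by simp
    then show ?thesis using Vd[OF V1 av] by (auto simp: W_def)
  qed (use av in \<open>auto simp: W_def\<close>)
  have bdd: "bdd_below W" by (rule bdd_belowI[of _ 1]) (simp add: W_def)
  have "Inf W \<ge> 1" using \<open>W \<noteq> {}\<close> by (intro cInf_greatest) (auto simp: W_def)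
  then have "Inf W < Inf W * (1 + e)" using e(1) by (simp add: algebra_simps)
  \<comment> \<open>A value within the factor 1 + e of the infimum is already the minimum, since a
    smaller one would be separated from it by the full gap.\<close>
  then obtain q where q: "q \<in> W" "q < Inf W * (1 + e)"
    using cInf_lessD[OF \<open>W \<noteq> {}\<close>] by blast
  have min: "q \<le> v" if "v \<in> W" for v
  proof (rule ccontr)
    assume "\<not> q \<le> v"
    then have "q \<ge> v * (1 + e)" using gap that q(1) by (auto simp: W_def)
    moreover have "v * (1 + e) \<ge> Inf W * (1 + e)"
      using cInf_lower[OF that bdd] e(1) by (intro mult_right_mono) auto
    ultimately show False using q(2) by linarith
  qed
  have q1: "q > 1" "q \<in> ?V" using q(1) by (auto simp: W_def)
  have "v \<in> range (\<lambda>i::int. q powi i)" if "v \<in> ?V" for v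
  proof -
    \<comment> \<open>With this exponent the quotient of v by q^i lies between 1 and q, with q
      excluded, so minimality of q makes it 1.\<close>
    define i where "i = \<lfloor>log q v\<rfloor>"
    have v: "v > 0" using that by (rule value_group_pos)
    have pos: "q powi i > 0" using q1 by simp
    have "q powr i \<le> q powr log q v" "q powr log q v < q powr (i + 1)"
      using q1 by (auto simp: i_def)
    then have le: "q powi i \<le> v" "v < q powi i * q"
      using q1 v by (auto simp: powr_real_of_int' powr_add)
    have "v / q powi i \<in> ?V" by (intro Vd that Vpowi q1)
    moreover have "v / q powi i < q" using le(2) pos by (simp add: pos_divide_less_eq mult.commute)
    ultimately have "\<not> v / q powi i > 1" using min by (force simp: W_def)
    then have "v = q powi i" using le(1) pos by (simp add: field_simps)
    then show ?thesis by blast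
  qed
  moreover have "range (\<lambda>i::int. q powi i) \<subseteq> ?V" using Vpowi q1 by blast
  ultimately show ?thesis using q1 by blast
qed

section \<open>Normalized vectors for the points over \<open>k\<close>\<close>

text \<open>One representative for each point of the projective line over \<open>k\<close>.\<close>
definition nvec :: "'a::field set \<Rightarrow> ('a^2) set" where
  "nvec k = insert (vector [1, 0]) ((\<lambda>y. vector [y, 1]) ` k)"

lemma nvec_nonzero: "v \<in> nvec k \<Longrightarrow> v \<noteq> 0"
  by (auto simp: nvec_def vec_eq_iff forall_2)

lemma affine_coords_proj_point:
  "z \<in> affine_coords (proj_point v) \<longleftrightarrow> (\<exists>c. c * v $ 2 \<noteq> 0 \<and> z = c * v $ 1 / (c * v $ 2))"
proof -
  have "affine_coords (proj_point v) = {(c *s v) $ 1 / (c *s v) $ 2 | c. (c *s v) $ 2 \<noteq> 0}"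
    unfolding affine_coords_def proj_point_def by blast
  then show ?thesis by simp blast
qed

lemma affine_coords_finite: "affine_coords (proj_point (vector [y, 1])) = {y}"
  by (auto simp: affine_coords_proj_point) (metis zero_neq_one)

lemma affine_coords_infinity: "affine_coords (proj_point (vector [1, 0])) = {}"
  by (auto simp: affine_coords_proj_point)

lemma nvec_of_affine_coords:
  assumes "v \<noteq> 0" "affine_coords (proj_point v) \<subseteq> k"
  shows "\<exists>c. c \<noteq> 0 \<and> c *s v \<in> nvec k"
proof (cases "v $ 2 = 0")
  case True
  then have "v $ 1 \<noteq> 0" using assms(1) by (auto simp: vec_eq_iff forall_2)
  then have "inverse (v $ 1) *s v = vector [1, 0]" using True by (intro vec2_eqI) auto
  then show ?thesis using \<open>v $ 1 \<noteq> 0\<close> by (intro exI[of _ "inverse (v $ 1)"]) (auto simp: nvec_def)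
next
  case False
  then have "v $ 1 / v $ 2 \<in> affine_coords (proj_point v)"
    unfolding affine_coords_proj_point by (intro exI[of _ 1]) simp
  then have "v $ 1 / v $ 2 \<in> k" using assms(2) by blast
  moreover have "inverse (v $ 2) *s v = vector [v $ 1 / v $ 2, 1]"
    using False by (intro vec2_eqI) (auto simp: divide_inverse)
  ultimately show ?thesis using False by (intro exI[of _ "inverse (v $ 2)"]) (auto simp: nvec_def)
qed

context subfield_set
begin

lemma nvec_mem: "v \<in> nvec k \<Longrightarrow> v $ i \<in> k"
  using exhaust_2[of i] by (auto simp: nvec_def)

lemma matrix_over_mem:
  assumes "matrix_over k A" "v \<in> nvec k"
  shows "(A *v v) $ i \<in> k"
  using assms nvec_mem[OF assms(2)] by (auto simp: matrix_vec2 matrix_over_def)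

lemma nvec_of_mem:
  assumes "v $ 1 \<in> k" "v $ 2 \<in> k" "v \<noteq> 0"
  shows "\<exists>c. c \<noteq> 0 \<and> c *s v \<in> nvec k"
proof -
  have "affine_coords (proj_point v) \<subseteq> k"
    using assms by (auto simp: affine_coords_proj_point)
  then show ?thesis using nvec_of_affine_coords assms(3) by blast
qed

text \<open>A normalized vector has a coordinate 1, so the eigenvalue appears as a coordinate of its
  image.\<close>

lemma eigenvalue_mem:
  assumes "matrix_over k A" "v \<in> nvec k" "A *v v = a *s v"
  shows "a \<in> k"
proof -
  have "a * v $ 1 \<in> k" "a * v $ 2 \<in> k"
    using matrix_over_mem[OF assms(1,2), unfolded assms(3)] by simp_all
  then show ?thesis using assms(2) by (auto simp: nvec_def)
qed

lemma lat_nvec_infinity: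
  assumes "y \<in> k"
  shows "lat k (kball k y 1) = ospan k (vector [1, 0]) (vector [y, 1])"
  using ball_lattice_ospan[OF assms one] lat_kball[OF assms, of 1] value_groupI[OF one] by simp

text \<open>This is the smallest ball that contains both points, where the path between them turns.
  Its basis vector (x - y, 0) is the difference of the two normalized vectors.\<close>

lemma lat_nvec_finite:
  assumes "x \<in> k" "y \<in> k" "x \<noteq> y"
  shows "lat k (kball k x (vabs (x - y))) = ospan k (vector [x, 1]) (vector [y, 1])"
proof -
  let ?x = "vector [x, 1] :: 'a^2" and ?y = "vector [y, 1] :: 'a^2"
  have "lat k (kball k x (vabs (x - y))) = ospan k (vector [x - y, 0]) ?x"
    using assms by (simp add: lat_kball value_groupI ball_lattice_ospan)
  also have "vector [x - y, 0] = (- 1) *s ?y + 1 *s ?x" by (intro vec2_eqI) auto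
  also have "ospan k ((- 1) *s ?y + 1 *s ?x) ?x = ospan k ?y ?x"
    by (subst ospan_add) (simp_all only: one vabs_1 order_refl ospan_scale uminus vabs_uminus)
  finally show ?thesis by (simp add: ospan_commute)
qed

end

lemma eventually_powi_le:
  fixes q e :: real
  assumes "q > 1" "e > 0"
  shows "\<forall>\<^sub>F n in sequentially. q powi (m - int n) \<le> e"
proof -
  have "(\<lambda>n. inverse q ^ n) \<longlonglongrightarrow> 0" using assms(1) by (intro LIMSEQ_realpow_zero) (auto simp: field_simps)
  from tendsto_mult_right_zero[OF this, of "q powi m"]
  have "\<forall>\<^sub>F n in sequentially. q powi m * inverse q ^ n < e"
    using assms(2) by (rule order_tendstoD(2))
  moreover have "q powi (m - int n) = q powi m * inverse q ^ n" for n
    using assms(1) by (simp add: power_int_diff power_inverse divide_inverse)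
  ultimately show ?thesis by (simp add: eventually_mono)
qed

lemma leads_to_finite:
  assumes q: "q > 1" and w: "\<And>n::nat. w n = kball k y (q powi (m - int n))"
  shows "leads_to k w (proj_point (vector [y, 1]))"
proof -
  have "\<forall>\<^sub>F n in sequentially. w n \<subseteq> cball y e" if "e > 0" for e
    using eventually_powi_le[OF q that, of m]
    by eventually_elim (auto simp: w kball_def dist_vabs)
  then show ?thesis by (simp add: leads_to_def affine_coords_finite)
qed

lemma leads_to_infinity:
  assumes q: "q > 1" and w: "\<And>n::nat. w n = kball k y (q powi int n)"
  shows "leads_to k w (proj_point (vector [1, 0]))"
proof -
  have "\<forall>\<^sub>F n in sequentially. kball k 0 R \<subseteq> w n" for R
  proof -
    obtain N where N: "max (vabs y) R < q ^ N" using real_arch_pow[OF q] by blast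
    have "max (vabs y) R \<le> q ^ n" if "n \<ge> N" for n
      using N power_increasing[OF that, of q] q by linarith
    then have "\<forall>\<^sub>F n in sequentially. max (vabs y) R \<le> q ^ n"
      by (rule eventually_sequentiallyI)
    then show ?thesis
    proof eventually_elim
      case (elim n)
      show ?case
      proof
        fix z assume "z \<in> kball k 0 R"
        then have "z \<in> k" "vabs (y - z) \<le> q ^ n"
          using elim by (auto simp: kball_def intro!: vabs_diff_le)
        then show "z \<in> w n" by (simp add: w kball_def)
      qed
    qed
  qed
  then show ?thesis by (simp add: leads_to_def affine_coords_infinity)
qed

section \<open>Explicit paths when the value group is generated by q\<close>

context subfield_set
begin

context
  fixes q :: real
  assumes q: "q > 1" and V: "value_group k = range (\<lambda>i::int. q powi i)"
begin

lemma powi_mem: "q powi i \<in> value_group k"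
  using V by blast

lemma powi_eq_iff: "q powi i = q powi j \<longleftrightarrow> i = j"
  using q by (metis linorder_neq_iff power_int_strict_increasing less_irrefl)

text \<open>No value lies strictly between consecutive powers of q, which is the condition for an
  edge. Both directions are recorded because a path may rise and descend.\<close>

lemma bt_tree_arc:
  assumes "y \<in> k"
  shows "(kball k y (q powi i), kball k y (q powi (i + 1))) \<in> parcs (bt_tree k)"
    "(kball k y (q powi (i + 1)), kball k y (q powi i)) \<in> parcs (bt_tree k)"
proof -
  have lt: "q powi i < q powi (i + 1)" using q by (intro power_int_strict_increasing) auto
  have between: "j = i \<or> j = i + 1" if "q powi i \<le> q powi j" "q powi j \<le> q powi (i + 1)" for j
  proof -
    have "\<not> j < i" "\<not> i + 1 < j"
      using that q power_int_strict_increasing[of j i q] power_int_strict_increasing[of "i + 1" j q]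
      by linarith+
    then show ?thesis by linarith
  qed
  then have int: "{q powi i..q powi (i + 1)} \<inter> value_group k = {q powi i, q powi (i + 1)}"
  proof (intro equalityI subsetI)
    fix z assume z: "z \<in> {q powi i..q powi (i + 1)} \<inter> value_group k"
    then obtain j where "z = q powi j" using V by blast
    then show "z \<in> {q powi i, q powi (i + 1)}" using z between[of j] by auto
  qed (use lt powi_mem in auto)
  have sub: "kball k y (q powi i) \<subseteq> kball k y (q powi (i + 1))"
    using lt by (auto simp: kball_def)
  let ?R = "{(kball k x r, kball k x' r') | x r x' r'.
       x \<in> k \<and> x' \<in> k \<and> r \<in> value_group k \<and> r' \<in> value_group k \<and>
       kball k x r \<subseteq> kball k x' r' \<and> {r..r'} \<inter> value_group k = {r, r'} \<and> r \<noteq> r'}"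
  have R: "(kball k y (q powi i), kball k y (q powi (i + 1))) \<in> ?R"
    by (intro CollectI exI conjI, rule refl) (rule assms int sub powi_mem less_imp_neq[OF lt])+
  then show "(kball k y (q powi i), kball k y (q powi (i + 1))) \<in> parcs (bt_tree k)"
    unfolding bt_tree_def symcl_def by simp
  show "(kball k y (q powi (i + 1)), kball k y (q powi i)) \<in> parcs (bt_tree k)"
    unfolding bt_tree_def symcl_def pair_pre_digraph.simps
    by (rule UnI2, rule image_eqI[OF _ R]) simp
qed

lemma joining_path_infinity:
  assumes "y \<in> k"
  shows "joining_path k (\<lambda>i. kball k y (q powi i))
    (proj_point (vector [y, 1])) (proj_point (vector [1, 0]))"
  unfolding joining_path_def
proof (intro conjI allI)
  show "inj (\<lambda>i. kball k y (q powi i))"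
    using kball_eqD(1)[OF _ assms assms powi_mem powi_mem] by (auto intro!: injI simp: powi_eq_iff)
  show "leads_to k (\<lambda>n. kball k y (q powi (- int n))) (proj_point (vector [y, 1]))"
    by (rule leads_to_finite[OF q, of _ k y 0]) simp
  show "leads_to k (\<lambda>n. kball k y (q powi int n)) (proj_point (vector [1, 0]))"
    by (rule leads_to_infinity[OF q]) simp
qed (rule bt_tree_arc[OF assms])

text \<open>The balls around \<open>x\<close> grow up to radius |x - y| at index 0, where they
  coincide with those around \<open>y\<close>; from there the balls around \<open>y\<close>
  shrink.\<close>

lemma joining_path_finite:
  assumes xy: "x \<in> k" "y \<in> k" and m: "vabs (x - y) = q powi m"
  shows "joining_path k (\<lambda>i. if i \<le> 0 then kball k x (q powi (m + i)) else kball k y (q powi (m - i)))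
    (proj_point (vector [x, 1])) (proj_point (vector [y, 1]))"
    (is "joining_path k ?w _ _")
  unfolding joining_path_def
proof (intro conjI allI)
  have ball_eq: "kball k x (q powi m) = kball k y (q powi m)"
    using m vabs_trans_le[of y x "q powi m"] vabs_trans_le[of x y "q powi m"]
    by (auto simp: kball_def vabs_minus_commute)
  \<comment> \<open>Equal balls have equal radii and centres within that radius. The latter needs a
    radius of at least q^m, but the second ball lies strictly below the turn as
    \<open>j > 0\<close>.\<close>
  have neq: "kball k x (q powi (m + i)) \<noteq> kball k y (q powi (m - j))" if "i \<le> 0" "j > 0" for i j
  proof
    assume eq: "kball k x (q powi (m + i)) = kball k y (q powi (m - j))"
    have "m + i = m - j" using kball_eqD(1)[OF eq xy powi_mem powi_mem] by (simp add: powi_eq_iff)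
    moreover have "q powi m \<le> q powi (m + i)" using kball_eqD(2)[OF eq xy powi_mem powi_mem] m by simp
    then have "\<not> m + i < m" using power_int_strict_increasing[of "m + i" m q] q by linarith
    ultimately show False using that by linarith
  qed
  show "inj ?w"
  proof (rule injI)
    fix i j assume "?w i = ?w j"
    then show "i = j"
      using neq[of i j] neq[of j i]
        kball_eqD(1)[OF _ xy(1) xy(1) powi_mem powi_mem, of "m + i" "m + j"]
        kball_eqD(1)[OF _ xy(2) xy(2) powi_mem powi_mem, of "m - i" "m - j"]
      by (auto simp: powi_eq_iff split: if_splits)
  qed
  show "leads_to k (\<lambda>n. ?w (- int n)) (proj_point (vector [x, 1]))"
    by (rule leads_to_finite[OF q, of _ k x m]) simp
  show "leads_to k (\<lambda>n. ?w (int n)) (proj_point (vector [y, 1]))"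
    by (rule leads_to_finite[OF q, of _ k y m]) (simp add: ball_eq)
  fix i :: int
  consider "i < 0" | "i = 0" | "i > 0" by linarith
  then show "(?w i, ?w (i + 1)) \<in> parcs (bt_tree k)"
  proof cases
    case 1
    then show ?thesis using bt_tree_arc(1)[OF xy(1), of "m + i"] by (simp add: add.assoc)
  next
    case 2
    then show ?thesis using bt_tree_arc(2)[OF xy(2), of "m - 1"] by (simp add: ball_eq)
  next
    case 3
    then show ?thesis using bt_tree_arc(2)[OF xy(2), of "m - i - 1"] by (simp add: algebra_simps)
  qed
qed

text \<open>The orientation is left open because the path between a finite point and infinity is
  constructed in the rising direction only.\<close>

lemma exists_joining_path:
  assumes "u \<in> nvec k" "v \<in> nvec k" "u \<noteq> v"
  shows "\<exists>w B. B \<in> range w \<and> B \<in> kballs k \<and> lat k B = ospan k u v \<and>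
    (joining_path k w (proj_point u) (proj_point v) \<or> joining_path k w (proj_point v) (proj_point u))"
proof -
  have inf: "\<exists>w B. B \<in> range w \<and> B \<in> kballs k \<and> lat k B = ospan k (vector [1, 0]) (vector [y, 1]) \<and>
    joining_path k w (proj_point (vector [y, 1])) (proj_point (vector [1, 0]))" if "y \<in> k" for y
  proof (intro exI conjI)
    show "kball k y 1 \<in> range (\<lambda>i. kball k y (q powi i))" by (rule image_eqI[of _ _ 0]) auto
    show "kball k y 1 \<in> kballs k" using that value_groupI[OF one] by (auto intro: kballs_memI)
  qed (rule lat_nvec_infinity[OF that], rule joining_path_infinity[OF that])
  have fin: "\<exists>w B. B \<in> range w \<and> B \<in> kballs k \<and> lat k B = ospan k (vector [x, 1]) (vector [y, 1]) \<and>
    joining_path k w (proj_point (vector [x, 1])) (proj_point (vector [y, 1]))"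
    if "x \<in> k" "y \<in> k" "x \<noteq> y" for x y
  proof -
    have "vabs (x - y) \<in> value_group k" using that by (intro value_groupI) auto
    then obtain m where m: "vabs (x - y) = q powi m" using V by auto
    show ?thesis
    proof (intro exI conjI)
      show "kball k x (vabs (x - y)) \<in> range (\<lambda>i. if i \<le> 0 then kball k x (q powi (m + i)) else kball k y (q powi (m - i)))"
        by (rule image_eqI[of _ _ 0]) (auto simp: m)
      show "kball k x (vabs (x - y)) \<in> kballs k" using that by (intro kballs_memI value_groupI) auto
    qed (rule lat_nvec_finite[OF that], rule joining_path_finite[OF that(1,2) m])
  qed
  have u: "u = vector [1, 0] \<or> (\<exists>x\<in>k. u = vector [x, 1])" and v: "v = vector [1, 0] \<or> (\<exists>y\<in>k. v = vector [y, 1])"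
    using assms by (auto simp: nvec_def)
  show ?thesis
  proof (cases "u = vector [1, 0]")
    case True
    then obtain y where "y \<in> k" "v = vector [y, 1]" using v assms(3) by blast
    then show ?thesis using inf[of y] True by blast
  next
    case False
    then obtain x where x: "x \<in> k" "u = vector [x, 1]" using u by blast
    show ?thesis
    proof (cases "v = vector [1, 0]")
      case True
      then show ?thesis using inf[OF x(1)] x(2) ospan_commute[of k u v] by simp blast
    next
      case False
      then obtain y where y: "y \<in> k" "v = vector [y, 1]" using v by blast
      then have "x \<noteq> y" using assms(3) x by blast
      then show ?thesis using fin[OF x(1) y(1)] x y by blast
    qed
  qed
qed

end

end

section \<open>Vertex groups and torsion\<close>

lemma limit_points_mono: "\<Gamma> \<subseteq> G \<Longrightarrow> limit_points \<Gamma> \<subseteq> limit_points G"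
  unfolding limit_points_def by blast

text \<open>Fewer elements produce fewer limit points, and each orbit closure becomes a closed
  subset of a compact one.\<close>

lemma discontinuous_subgroup:
  assumes "discontinuous G" "subgroup \<Gamma> PGL2" "\<Gamma> \<subseteq> G"
  shows "discontinuous \<Gamma>"
  unfolding discontinuous_def
proof (intro conjI ballI)
  show "ordinary_points \<Gamma> \<noteq> {}"
    using assms limit_points_mono[OF assms(3)] by (auto simp: discontinuous_def ordinary_points_def)
  fix x :: "('a^2) set" assume "x \<in> P1"
  then have "compactin P1_topology (P1_topology closure_of {P1_act \<gamma> x | \<gamma>. \<gamma> \<in> G})"
    using assms(1) by (auto simp: discontinuous_def)
  moreover have "P1_topology closure_of {P1_act \<gamma> x | \<gamma>. \<gamma> \<in> \<Gamma>}
      \<subseteq> P1_topology closure_of {P1_act \<gamma> x | \<gamma>. \<gamma> \<in> G}"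
    using assms(3) by (intro closure_of_mono) blast
  ultimately show "compactin P1_topology (P1_topology closure_of {P1_act \<gamma> x | \<gamma>. \<gamma> \<in> \<Gamma>})"
    by (rule closed_compactin) simp
qed (rule assms)

lemma (in subfield_set) PGL2_over_generate:
  assumes "M \<subseteq> carrier GL2" "\<And>A. A \<in> M \<Longrightarrow> matrix_over k A"
  shows "generate PGL2 (PGL2_class ` M) \<subseteq> PGL2_over k"
proof
  interpret P: Group.group "PGL2 :: ('a^2^2) set monoid" by (rule group_PGL2)
  have M: "invertible A" if "A \<in> M" for A using assms(1) that by (auto simp: GL2_def)
  then have cM: "PGL2_class A \<in> carrier PGL2" if "A \<in> M" for A
    using that by (auto simp: carrier_PGL2)
  fix \<gamma> assume "\<gamma> \<in> generate PGL2 (PGL2_class ` M)"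
  then show "\<gamma> \<in> PGL2_over k"
  proof (induction rule: generate.induct)
    case one
    have "matrix_over k (mat 1)" by (auto simp: matrix_over_def mat_def)
    then show ?case using mem_one_PGL2 by (auto simp: PGL2_over_def)
  next
    case (incl \<gamma>)
    then show ?case using cM assms(2) PGL2_class_self by (auto simp: PGL2_over_def)
  next
    case (inv \<gamma>)
    then obtain A where A: "A \<in> M" "\<gamma> = PGL2_class A" by blast
    define d where "d = det A"
    have d: "d \<noteq> 0" using M[OF A(1)] by (simp add: invertible_det_nz d_def)
    have det: "A $ 1 $ 1 * A $ 2 $ 2 - A $ 1 $ 2 * A $ 2 $ 1 = d" by (simp add: det_2 d_def)
    \<comment> \<open>The adjugate divided by the determinant, an inverse of \<open>A\<close> with
      entries visibly in \<open>k\<close>.\<close>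
    define B :: "'a^2^2" where "B = vector [vector [A $ 2 $ 2 / d, - (A $ 1 $ 2 / d)],
      vector [- (A $ 2 $ 1 / d), A $ 1 $ 1 / d]]"
    have B: "B $ 1 $ 1 = A $ 2 $ 2 / d" "B $ 1 $ 2 = - (A $ 1 $ 2 / d)"
      "B $ 2 $ 1 = - (A $ 2 $ 1 / d)" "B $ 2 $ 2 = A $ 1 $ 1 / d" by (simp_all add: B_def)
    have "(A ** B) $ 1 $ 1 = (A $ 1 $ 1 * A $ 2 $ 2 - A $ 1 $ 2 * A $ 2 $ 1) / d" "(A ** B) $ 1 $ 2 = 0"
      "(A ** B) $ 2 $ 1 = 0" "(A ** B) $ 2 $ 2 = (A $ 1 $ 1 * A $ 2 $ 2 - A $ 1 $ 2 * A $ 2 $ 1) / d"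
      by (simp_all add: matrix_matrix_mult_def sum_2 B diff_divide_distrib mult.commute)
    then have "A ** B = mat 1" using d unfolding det by (simp add: vec_eq_iff forall_2 mat_def)
    then have "B \<in> inv\<^bsub>PGL2\<^esub> \<gamma>"
      using mem_inv_PGL2[OF cM[OF A(1)] PGL2_class_self] A(2) by simp
    moreover have Ak: "A $ i $ j \<in> k" for i j using assms(2)[OF A(1)] by (simp add: matrix_over_def)
    have "d \<in> k" unfolding det[symmetric] by (intro diff mult Ak)
    then have "matrix_over k B" by (simp add: matrix_over_def forall_2 B Ak)
    ultimately show ?case using cM[OF A(1)] A(2) by (auto simp: PGL2_over_def)
  next
    case (eng \<gamma> \<delta>)
    then obtain A D where A: "\<gamma> \<in> carrier PGL2" "A \<in> \<gamma>" "matrix_over k A"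
      and D: "\<delta> \<in> carrier PGL2" "D \<in> \<delta>" "matrix_over k D" by (auto simp: PGL2_over_def)
    have "matrix_over k (A ** D)"
      using A(3) D(3) by (auto simp: matrix_over_def matrix_matrix_mult_def sum_2)
    then show ?case using mem_mult_PGL2[OF A(2) D(2)] A(1) D(1) by (auto simp: PGL2_over_def)
  qed
qed

section \<open>Eigenvectors over the coefficient field\<close>

lemma invertible_mult_eq_0:
  fixes A :: "'a::field^2^2"
  assumes "invertible A"
  shows "A *v v = 0 \<longleftrightarrow> v = 0"
proof -
  obtain B where "B ** A = mat 1" using assms by (auto simp: invertible_def)
  then have "B *v (A *v v) = v" by (simp add: matrix_vector_mul_assoc)
  then show ?thesis by (metis matrix_vector_mult_0_right)
qed

lemma fixed_points_eigenvector:
  assumes "\<gamma> \<in> carrier PGL2" "A \<in> \<gamma>" "A *v v = a *s v" "v \<noteq> 0"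
  shows "proj_point v \<in> fixed_points \<gamma>"
proof -
  have "a \<noteq> 0"
    using invertible_mult_eq_0[OF PGL2_invertible[OF assms(1,2)], of v] assms(3,4) by auto
  then show ?thesis
    using P1_act_proj_point[OF assms(1,2), of v] assms
    by (auto simp: fixed_points_def P1_def proj_point_scale)
qed

text \<open>Only fixed points of the representatives are adjoined to \<open>k\<close>. For a
  conjugate of \<open>\<epsilon>\<close> by \<open>\<delta>\<close>, the eigenvectors are images of
  those of \<open>\<epsilon>\<close> under a matrix of \<open>\<delta>\<close> over
  \<open>k\<close>, so they can be normalized over \<open>k\<close> as well.\<close>

lemma (in subfield_set) elliptic_eigenbasis:
  assumes G: "subgroup G PGL2" "G \<subseteq> PGL2_over k"
    and E: "elliptic_representatives G E" "(\<Union>\<epsilon>\<in>E. \<Union>x\<in>fixed_points \<epsilon>. affine_coords x) \<subseteq> k"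
    and \<gamma>: "\<gamma> \<in> G" "elliptic \<gamma>"
  shows "\<exists>A\<in>\<gamma>. \<exists>a b u w. u \<in> nvec k \<and> w \<in> nvec k \<and> u \<noteq> w \<and> A *v u = a *s u \<and> A *v w = b *s w
    \<and> a \<in> k \<and> b \<in> k \<and> vabs a = vabs b \<and> b \<noteq> 0"
proof -
  interpret P: Group.group "PGL2 :: ('a^2^2) set monoid" by (rule group_PGL2)
  interpret G: subgroup G PGL2 by fact
  obtain \<epsilon> \<delta> where \<epsilon>: "\<epsilon> \<in> E" "\<epsilon> \<in> G" "elliptic \<epsilon>" and \<delta>: "\<delta> \<in> G"
    and eq: "\<gamma> = \<delta> \<otimes>\<^bsub>PGL2\<^esub> \<epsilon> \<otimes>\<^bsub>PGL2\<^esub> inv\<^bsub>PGL2\<^esub> \<delta>"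
  proof -
    have "\<exists>\<epsilon>. \<epsilon> \<in> E \<and> (\<exists>\<delta>\<in>G. \<gamma> = \<delta> \<otimes>\<^bsub>PGL2\<^esub> \<epsilon> \<otimes>\<^bsub>PGL2\<^esub> inv\<^bsub>PGL2\<^esub> \<delta>)"
      by (rule ex1_implies_ex) (use E(1) \<gamma> in \<open>simp add: elliptic_representatives_def\<close>)
    moreover have "E \<subseteq> {\<gamma>\<in>G. elliptic \<gamma>}" using E(1) by (simp add: elliptic_representatives_def)
    ultimately show thesis using that by blast
  qed
  obtain A a b v w where A: "A \<in> \<epsilon>" "a \<noteq> b" "vabs a = vabs b" "v \<noteq> 0" "A *v v = a *s v" "w \<noteq> 0" "A *v w = b *s w"
    using \<epsilon>(3) unfolding elliptic_def by blast
  obtain D where D: "D \<in> \<delta>" "matrix_over k D" using \<delta> G(2) by (auto simp: PGL2_over_def)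
  have invD: "invertible D" using PGL2_invertible[OF _ D(1)] \<delta> by simp
  obtain D' where D': "D ** D' = mat 1" "D' ** D = mat 1" using invD unfolding invertible_def by blast
  have D'm: "D' \<in> inv\<^bsub>PGL2\<^esub> \<delta>" using mem_inv_PGL2[OF _ D(1) D'(1)] \<delta> by simp
  define C where "C = D ** A ** D'"
  have C: "C \<in> \<gamma>" unfolding eq C_def by (intro mem_mult_PGL2 D A D'm)
  have \<gamma>c: "\<gamma> \<in> carrier PGL2" using \<gamma> by simp
  \<comment> \<open>The eigenvectors of \<open>C\<close> are known, but its entries need not lie in
    \<open>k\<close>. The proportional matrix \<open>F\<close> over \<open>k\<close> has the same
    eigenvectors, and its eigenvalues, multiplied by \<open>c\<close>, lie in
    \<open>k\<close>.\<close>
  obtain F where F: "F \<in> \<gamma>" "matrix_over k F" using \<gamma>(1) G(2) by (auto simp: PGL2_over_def)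
  obtain c where c: "c \<noteq> 0" "F = mat c ** C" using PGL2_mem_unique[OF \<gamma>c C F(1)] by metis
  have key: "\<exists>u\<in>nvec k. F *v u = (c * l) *s u" if v: "v \<noteq> 0" "A *v v = l *s v" for v l
  proof -
    have "affine_coords (proj_point v) \<subseteq> k"
      using E(2) \<epsilon>(1) fixed_points_eigenvector[OF G.mem_carrier[OF \<epsilon>(2)] A(1) v(2,1)] by blast
    then obtain d where d: "d \<noteq> 0" "d *s v \<in> nvec k" using nvec_of_affine_coords[OF v(1)] by blast
    have nz: "D *v (d *s v) \<noteq> 0" using invertible_mult_eq_0[OF invD] nvec_nonzero[OF d(2)] by simp
    then obtain e where e: "e \<noteq> 0" "e *s (D *v (d *s v)) \<in> nvec k"
      using nvec_of_mem[OF matrix_over_mem[OF D(2) d(2)] matrix_over_mem[OF D(2) d(2)] nz] by blast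
    have "C *v (D *v v) = D *v (A *v ((D' ** D) *v v))"
      by (simp add: C_def matrix_vector_mul_assoc matrix_mul_assoc)
    also have "\<dots> = l *s (D *v v)" by (simp add: D' v matrix_vec_scale)
    finally have "F *v (e *s (D *v (d *s v))) = (c * l) *s (e *s (D *v (d *s v)))"
      by (simp add: c mat_mult_vec_scale matrix_vec_scale vector_smult_assoc mult_ac)
    then show ?thesis using e by blast
  qed
  obtain u where u: "u \<in> nvec k" "F *v u = (c * a) *s u" using key[OF A(4,5)] by (elim bexE)
  obtain u' where u': "u' \<in> nvec k" "F *v u' = (c * b) *s u'" using key[OF A(6,7)] by (elim bexE)
  have "u \<noteq> u'"
  proof
    assume "u = u'"
    then have "(c * a) *s u = (c * b) *s u" using u(2) u'(2) by metis
    then show False using c(1) A(2) nvec_nonzero[OF u(1)] by auto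
  qed
  moreover have "b \<noteq> 0" using A(2,3) by auto
  moreover have "c * a \<in> k" "c * b \<in> k" by (rule eigenvalue_mem[OF F(2) u], rule eigenvalue_mem[OF F(2) u'])
  moreover have "vabs (c * a) = vabs (c * b)" using A(3) by (simp add: vabs_mult)
  ultimately show ?thesis using u u' c(1)
    by (intro bexI[OF _ F(1)] exI[of _ "c * a"] exI[of _ "c * b"] exI[of _ u] exI[of _ u'] conjI) simp_all
qed

lemma coefficient_field_facts:
  fixes k :: "'a::complete_valued_field set"
  assumes "coefficient_field G k"
  obtains E where "subfield_set k" "Qp \<subseteq> k" "G \<subseteq> PGL2_over k" "elliptic_representatives G E"
    "(\<Union>\<epsilon>\<in>E. \<Union>x\<in>fixed_points \<epsilon>. affine_coords x) \<subseteq> k"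
proof -
  obtain M E where ME: "M \<subseteq> carrier GL2" "generate PGL2 (PGL2_class ` M) = G" "elliptic_representatives G E"
    and k: "k = generate_field ring_of_type_algebra
           (Qp \<union> {A $ i $ j | A i j. A \<in> M} \<union> (\<Union>\<epsilon>\<in>E. \<Union>x\<in>fixed_points \<epsilon>. affine_coords x))"
    using assms unfolding coefficient_field_def by auto
  interpret subfield_set k unfolding k by (rule subfield_set_generate_field)
  have sub: "Qp \<union> {A $ i $ j | A i j. A \<in> M} \<union> (\<Union>\<epsilon>\<in>E. \<Union>x\<in>fixed_points \<epsilon>. affine_coords x) \<subseteq> k"
    unfolding k by (blast intro: generate_field.incl)
  have "matrix_over k A" if "A \<in> M" for A
    using sub that unfolding matrix_over_def by blast
  then have "G \<subseteq> PGL2_over k" using PGL2_over_generate[OF ME(1)] ME(2) by blast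
  moreover have "Qp \<subseteq> k" using sub by blast
  moreover have "(\<Union>\<epsilon>\<in>E. \<Union>x\<in>fixed_points \<epsilon>. affine_coords x) \<subseteq> k"
    using sub by blast
  ultimately show ?thesis using that[OF subfield_set_axioms] ME(3) by blast
qed

section \<open>Vertices and vertex groups of the quotient graph\<close>

lemma joining_path_kballs:
  assumes "joining_path k w x y"
  shows "w i \<in> kballs k"
proof -
  have "(w i, w (i + 1)) \<in> parcs (bt_tree k)" using assms by (simp add: joining_path_def)
  then show ?thesis by (auto simp: bt_tree_def symcl_def kballs_def)
qed

lemma pverts_fixed_point_subtree:
  "pverts (fixed_point_subtree k G) =
    {w i | w i. \<exists>x\<in>all_fixed_points G. \<exists>y\<in>all_fixed_points G. joining_path k w x y}"
  by (simp add: fixed_point_subtree_def Let_def)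

lemma parcs_fixed_point_subtree:
  assumes "(B, B') \<in> parcs (fixed_point_subtree k G)"
  shows "B \<in> kballs k" "B' \<in> kballs k"
proof -
  from assms obtain w i x y where "joining_path k w x y" "(B, B') = (w i, w (i + 1)) \<or> (B, B') = (w (i + 1), w i)"
    by (auto simp: fixed_point_subtree_def Let_def symcl_def)
  then show "B \<in> kballs k" "B' \<in> kballs k" using joining_path_kballs by blast+
qed

text \<open>\<open>B\<close> and \<open>B'\<close> may coincide, so original vertices and midpoints
  of edges are covered by one form.\<close>

lemma pverts_reduced_tree:
  assumes "Z \<in> pverts (reduced_tree k G)"
  shows "\<exists>B\<in>kballs k. \<exists>B'\<in>kballs k. Z = {B, B'}"
proof -
  let ?T = "fixed_point_subtree k G"
  from assms consider B where "B \<in> pverts ?T" "Z = {B}"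
    | B B' where "(B, B') \<in> parcs ?T" "Z = {B, B'}"
    by (auto simp: reduced_tree_def subdivision_def)
  then show ?thesis
  proof cases
    case 1
    then obtain w i x y where "joining_path k w x y" "B = w i"
      by (auto simp: pverts_fixed_point_subtree)
    then have "B \<in> kballs k" using joining_path_kballs by blast
    then show ?thesis using 1(2) by (intro bexI[of _ B]) auto
  next
    case 2
    then show ?thesis using parcs_fixed_point_subtree[OF 2(1)] by blast
  qed
qed

lemma joining_path_pverts:
  assumes "joining_path k w x y" "x \<in> all_fixed_points G" "y \<in> all_fixed_points G"
  shows "{w i} \<in> pverts (reduced_tree k G)"
proof -
  have "w i \<in> pverts (fixed_point_subtree k G)"
    unfolding pverts_fixed_point_subtree using assms by blast
  then show ?thesis by (simp add: reduced_tree_def subdivision_def)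
qed

text \<open>The label of an orbit collects the stabilizers of all its members, hence the translates
  by \<open>\<delta>\<close>.\<close>

lemma vertex_groups_reduced_quotient_graph:
  "vertex_groups (reduced_quotient_graph k G) =
    (\<Union>Z\<in>pverts (reduced_tree k G). \<Union>\<delta>\<in>G. {{\<gamma> \<in> G. bt_act k \<gamma> ` (bt_act k \<delta> ` Z) = bt_act k \<delta> ` Z}})"
proof -
  have "orbit (PGL2\<lparr>carrier := G\<rparr>) (\<lambda>\<gamma>. (`) (bt_act k \<gamma>)) Z = (\<lambda>\<delta>. bt_act k \<delta> ` Z) ` G" for Z
    by (auto simp: orbit_def)
  then have "orbits (PGL2\<lparr>carrier := G\<rparr>) (pverts (reduced_tree k G)) (\<lambda>\<gamma>. (`) (bt_act k \<gamma>))
      = (\<lambda>Z. (\<lambda>\<delta>. bt_act k \<delta> ` Z) ` G) ` pverts (reduced_tree k G)"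
    by (auto simp: orbits_def)
  then show ?thesis
    by (simp add: vertex_groups_def reduced_quotient_graph_def quotient_graph_def stabilizer_def UNION_singleton_eq_range image_image)
qed

text \<open>Such an element fixes both balls or interchanges them. In either case its square fixes
  \<open>B\<close> and has finite order, which costs at most a factor 2.\<close>

lemma (in subfield_set) setwise_stabilizer_finite_order:
  assumes "discontinuous G" "G \<subseteq> PGL2_over k" "\<gamma> \<in> G" "B \<in> kballs k" "B' \<in> kballs k"
    and inv: "bt_act k \<gamma> ` {B, B'} = {B, B'}"
  shows "\<exists>n>0. \<gamma> [^]\<^bsub>PGL2\<^esub> (n::nat) = \<one>\<^bsub>PGL2\<^esub>"
proof -
  interpret P: Group.group "PGL2 :: ('a^2^2) set monoid" by (rule group_PGL2)
  interpret G: subgroup G PGL2 using assms(1) by (simp add: discontinuous_def)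
  have \<gamma>: "\<gamma> \<in> PGL2_over k" using assms(2,3) by blast
  have "bt_act k (\<gamma> \<otimes>\<^bsub>PGL2\<^esub> \<gamma>) B = bt_act k \<gamma> (bt_act k \<gamma> B)"
    by (rule bt_act_mult[OF \<gamma> \<gamma> assms(4)])
  also have "\<dots> = B" using inv by (auto simp: doubleton_eq_iff)
  finally obtain n where n: "n > 0" "(\<gamma> \<otimes>\<^bsub>PGL2\<^esub> \<gamma>) [^]\<^bsub>PGL2\<^esub> (n::nat) = \<one>\<^bsub>PGL2\<^esub>"
    using vertex_stabilizer_finite_order[OF assms(1,2) G.m_closed[OF assms(3,3)] assms(4)] by blast
  have "\<gamma> \<otimes>\<^bsub>PGL2\<^esub> \<gamma> = \<gamma> [^]\<^bsub>PGL2\<^esub> (2::nat)"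
    using assms(3) by (simp add: numeral_2_eq_2)
  then have "\<gamma> [^]\<^bsub>PGL2\<^esub> (2 * n) = \<one>\<^bsub>PGL2\<^esub>"
    using n(2) assms(3) by (simp add: P.nat_pow_pow)
  then show ?thesis using n(1) by (intro exI[of _ "2 * n"]) simp
qed

lemma (in subfield_set) bt_act_image_mult:
  assumes "\<gamma> \<in> PGL2_over k" "\<delta> \<in> PGL2_over k" "Z \<subseteq> kballs k"
  shows "bt_act k (\<gamma> \<otimes>\<^bsub>PGL2\<^esub> \<delta>) ` Z = bt_act k \<gamma> ` (bt_act k \<delta> ` Z)"
  unfolding image_image
  by (intro image_cong refl bt_act_mult assms subsetD[OF assms(3)])

lemma (in subfield_set) bt_act_image_one:
  assumes "Z \<subseteq> kballs k"
  shows "bt_act k \<one>\<^bsub>PGL2\<^esub> ` Z = Z"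
proof -
  have "bt_act k \<one>\<^bsub>PGL2\<^esub> ` Z = (\<lambda>B. B) ` Z"
    by (intro image_cong refl bt_act_one subsetD[OF assms])
  then show ?thesis by simp
qed

theorem corollary5p3:
  fixes p :: nat
    and H :: "('h, 'm) monoid_scheme"
    and G \<Gamma> :: "('a::complete_valued_field^2^2) set set"
    and \<phi> :: "('a^2^2) set \<Rightarrow> 'h"
    and k :: "'a set"
  assumes "Factorial_Ring.prime p"
    and "is_Cp p TYPE('a)"
    and "group H" and "finite (carrier H)"
    and "subgroup G PGL2" and "finitely_generated PGL2 G" and "discontinuous G"
    and "coefficient_field G k" and "discrete (value_group k)"
    and "\<phi> \<in> hom (PGL2\<lparr>carrier := G\<rparr>) H"
    and "\<Gamma> = kernel (PGL2\<lparr>carrier := G\<rparr>) H \<phi>"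
  shows "schottky \<Gamma> \<longleftrightarrow>
    (\<forall>G\<^sub>i\<in>vertex_groups (reduced_quotient_graph k G). inj_on \<phi> G\<^sub>i)"
proof -
  interpret P: Group.group "PGL2 :: ('a^2^2) set monoid" by (rule group_PGL2)
  interpret G: subgroup G PGL2 by fact
  interpret H: Group.group H by fact
  interpret \<phi>: group_hom "PGL2\<lparr>carrier := G\<rparr>" H \<phi>
    by (intro group_hom.intro group_hom_axioms.intro P.subgroup_imp_group assms)
  obtain E where "subfield_set k" and Qp: "Qp \<subseteq> k" and Gk: "G \<subseteq> PGL2_over k"
    and E: "elliptic_representatives G E" "(\<Union>\<epsilon>\<in>E. \<Union>x\<in>fixed_points \<epsilon>. affine_coords x) \<subseteq> k"
    by (rule coefficient_field_facts[OF assms(8)]) blast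
  interpret subfield_set k by fact
  have \<Gamma>: "\<Gamma> = {\<gamma> \<in> G. \<phi> \<gamma> = \<one>\<^bsub>H\<^esub>}" using assms(11) by (simp add: kernel_def)
  have \<Gamma>G: "\<Gamma> \<subseteq> G" unfolding \<Gamma> by blast
  have \<Gamma>sub: "subgroup \<Gamma> PGL2"
    unfolding assms(11) by (rule P.incl_subgroup[OF assms(5) \<phi>.subgroup_kernel])
  show ?thesis
  proof
    assume schottky: "schottky \<Gamma>"
    show "\<forall>G\<^sub>i\<in>vertex_groups (reduced_quotient_graph k G). inj_on \<phi> G\<^sub>i"
    proof
      fix G\<^sub>i assume "G\<^sub>i \<in> vertex_groups (reduced_quotient_graph k G)"
      then obtain Z \<delta> where Z: "Z \<in> pverts (reduced_tree k G)" "\<delta> \<in> G"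
        and Gi: "G\<^sub>i = {\<gamma> \<in> G. bt_act k \<gamma> ` (bt_act k \<delta> ` Z) = bt_act k \<delta> ` Z}"
        unfolding vertex_groups_reduced_quotient_graph by blast
      obtain B B' where B: "B \<in> kballs k" "B' \<in> kballs k" "Z = {B, B'}"
        using pverts_reduced_tree[OF Z(1)] by blast
      have \<delta>k: "\<delta> \<in> PGL2_over k" using Z(2) Gk by blast
      \<comment> \<open>The group in question stabilizes a translate of the vertex \<open>Z\<close>.
        The argument below uses of it that it consists of at most two balls.\<close>
      define Y where "Y = bt_act k \<delta> ` Z"
      have Y: "Y = {bt_act k \<delta> B, bt_act k \<delta> B'}" by (simp add: Y_def B(3))
      note Yk = bt_act_lat(1)[OF \<delta>k B(1)] bt_act_lat(1)[OF \<delta>k B(2)]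
      then have Ysub: "Y \<subseteq> kballs k" by (simp add: Y)
      show "inj_on \<phi> G\<^sub>i"
      proof (rule inj_onI)
        fix \<gamma> \<eta> assume \<gamma>: "\<gamma> \<in> G\<^sub>i" and \<eta>: "\<eta> \<in> G\<^sub>i" and eq: "\<phi> \<gamma> = \<phi> \<eta>"
        have \<gamma>G: "\<gamma> \<in> G" "bt_act k \<gamma> ` Y = Y" and \<eta>G: "\<eta> \<in> G" "bt_act k \<eta> ` Y = Y"
          using \<gamma> \<eta> by (simp_all add: Gi Y_def)
        let ?i = "inv\<^bsub>PGL2\<^esub> \<eta>"
        have iG: "?i \<in> G" using \<eta>G(1) by (rule G.m_inv_closed)
        have "bt_act k ?i ` Y = bt_act k ?i ` (bt_act k \<eta> ` Y)" using \<eta>G(2) by simp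
        also have "\<dots> = bt_act k (?i \<otimes>\<^bsub>PGL2\<^esub> \<eta>) ` Y"
          using bt_act_image_mult[OF _ _ Ysub, of ?i \<eta>] iG \<eta>G(1) Gk by blast
        also have "\<dots> = Y" using \<eta>G(1) bt_act_image_one[OF Ysub] by (simp add: P.l_inv)
        finally have iY: "bt_act k ?i ` Y = Y" .
        \<comment> \<open>The quotient stabilizes \<open>Y\<close> and lies in the kernel; torsion
          in a torsion-free group is trivial, so the two elements agree.\<close>
        define \<zeta> where "\<zeta> = \<gamma> \<otimes>\<^bsub>PGL2\<^esub> ?i"
        have \<zeta>G: "\<zeta> \<in> G" unfolding \<zeta>_def by (rule G.m_closed[OF \<gamma>G(1) iG])
        have "bt_act k \<zeta> ` Y = bt_act k \<gamma> ` (bt_act k ?i ` Y)"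
          unfolding \<zeta>_def using bt_act_image_mult[OF _ _ Ysub, of \<gamma> ?i] iG \<gamma>G(1) Gk by blast
        then have "bt_act k \<zeta> ` Y = Y" using iY \<gamma>G(2) by simp
        then obtain n where n: "n > 0" "\<zeta> [^]\<^bsub>PGL2\<^esub> (n::nat) = \<one>\<^bsub>PGL2\<^esub>"
          using setwise_stabilizer_finite_order[OF assms(7) Gk \<zeta>G Yk] unfolding Y by blast
        have "\<phi> ?i = inv\<^bsub>H\<^esub> (\<phi> \<eta>)"
          using \<phi>.hom_inv[of \<eta>] \<eta>G(1) P.m_inv_consistent[OF assms(5) \<eta>G(1)] by simp
        moreover have "\<phi> \<zeta> = \<phi> \<gamma> \<otimes>\<^bsub>H\<^esub> \<phi> ?i"
          unfolding \<zeta>_def using \<phi>.hom_mult[of \<gamma> ?i] \<gamma>G(1) iG by simp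
        moreover have "\<phi> \<eta> \<in> carrier H" using \<phi>.hom_closed[of \<eta>] \<eta>G(1) by simp
        ultimately have "\<phi> \<zeta> = \<one>\<^bsub>H\<^esub>" using eq by simp
        then have "\<zeta> \<in> \<Gamma>" using \<zeta>G by (simp add: \<Gamma>)
        then have "\<zeta> = \<one>\<^bsub>PGL2\<^esub>" using schottky n unfolding schottky_def by blast
        then show "\<gamma> = \<eta>"
          unfolding \<zeta>_def using P.inv_equality[of \<gamma> ?i] \<gamma>G(1) \<eta>G(1) by simp
      qed
    qed
  next
    assume inj: "\<forall>G\<^sub>i\<in>vertex_groups (reduced_quotient_graph k G). inj_on \<phi> G\<^sub>i"
    show "schottky \<Gamma>"
      unfolding schottky_def
    proof (intro conjI ballI impI allI)
      show "finitely_generated PGL2 \<Gamma>"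
        unfolding assms(11)
        by (rule finitely_generated_kernel[OF P.group_axioms assms(5,6,3,4,10)])
      show "discontinuous \<Gamma>" by (rule discontinuous_subgroup[OF assms(7) \<Gamma>sub \<Gamma>G])
      fix \<gamma> and n :: nat
      assume \<gamma>: "\<gamma> \<in> \<Gamma>" "\<gamma> \<noteq> \<one>\<^bsub>PGL2\<^esub>" and n: "n > 0"
      show "\<gamma> [^]\<^bsub>PGL2\<^esub> n \<noteq> \<one>\<^bsub>PGL2\<^esub>"
      proof
        assume pow: "\<gamma> [^]\<^bsub>PGL2\<^esub> n = \<one>\<^bsub>PGL2\<^esub>"
        have \<gamma>G: "\<gamma> \<in> G" using \<gamma>(1) \<Gamma>G by blast
        then have \<gamma>c: "\<gamma> \<in> carrier PGL2" by simp
        have "elliptic \<gamma>" by (rule finite_order_elliptic[OF assms(2) \<gamma>c \<gamma>(2) n pow])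
        then obtain A a b u w where A: "A \<in> \<gamma>" and uw: "u \<in> nvec k" "w \<in> nvec k" "u \<noteq> w"
          and ev: "A *v u = a *s u" "A *v w = b *s w" "a \<in> k" "b \<in> k" "vabs a = vabs b" "b \<noteq> 0"
          using elliptic_eigenbasis[OF assms(5) Gk E \<gamma>G] by blast
        \<comment> \<open>The prime provides an element of \<open>k\<close> whose absolute value 1/p
          differs from 0 and 1, so the value group is not trivial.\<close>
        have p: "of_nat p \<in> k" "vabs (of_nat p :: 'a) \<noteq> 1" "(of_nat p :: 'a) \<noteq> 0"
        proof -
          have "of_nat p \<in> (\<rat> :: 'a set)" by simp
          then have "of_nat p \<in> (Qp :: 'a set)" unfolding Qp_def using closure_subset by blast
          then show "of_nat p \<in> k" using Qp by blast
          have "p > 1" using assms(1) by (rule prime_gt_1_nat)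
          then show "vabs (of_nat p :: 'a) \<noteq> 1" "(of_nat p :: 'a) \<noteq> 0"
            using assms(2) by (auto simp: is_Cp_def)
        qed
        obtain q where q: "q > 1" "value_group k = range (\<lambda>i::int. q powi i)"
          using value_group_powers[OF assms(9) p(1,3,2)] by blast
        obtain path B where B: "B \<in> range path" "B \<in> kballs k" "lat k B = ospan k u w"
          and path: "joining_path k path (proj_point u) (proj_point w) \<or> joining_path k path (proj_point w) (proj_point u)"
          using exists_joining_path[OF q uw] by blast
        have "proj_point u \<in> all_fixed_points G" "proj_point w \<in> all_fixed_points G"
          using fixed_points_eigenvector[OF \<gamma>c A ev(1) nvec_nonzero[OF uw(1)]]
            fixed_points_eigenvector[OF \<gamma>c A ev(2) nvec_nonzero[OF uw(2)]] \<gamma>G \<gamma>(2)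
          by (auto simp: all_fixed_points_def)
        then have Z: "{B} \<in> pverts (reduced_tree k G)"
          using path joining_path_pverts B(1) by blast
        \<comment> \<open>The translate by the identity is kept to match the listed form of the
          vertex groups; \<open>\<gamma>\<close> and the identity both belong to this group and have
          the same image.\<close>
        define G\<^sub>B where "G\<^sub>B = {\<gamma> \<in> G. bt_act k \<gamma> ` (bt_act k \<one>\<^bsub>PGL2\<^esub> ` {B}) = bt_act k \<one>\<^bsub>PGL2\<^esub> ` {B}}"
        have "G\<^sub>B \<in> vertex_groups (reduced_quotient_graph k G)"
          unfolding vertex_groups_reduced_quotient_graph G\<^sub>B_def using Z G.one_closed by blast
        then have inj: "inj_on \<phi> G\<^sub>B" using inj by blast
        have "bt_act k \<gamma> B = B"
          by (rule bt_act_eigenbasis[OF \<gamma>c A B(2,3) ev])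
        then have "\<gamma> \<in> G\<^sub>B" "\<one>\<^bsub>PGL2\<^esub> \<in> G\<^sub>B"
          using \<gamma>G G.one_closed bt_act_one[OF B(2)] by (simp_all add: G\<^sub>B_def)
        moreover have "\<phi> \<gamma> = \<phi> \<one>\<^bsub>PGL2\<^esub>" using \<gamma>(1) \<phi>.hom_one by (simp add: \<Gamma>)
        ultimately show False using inj_onD[OF inj] \<gamma>(2) by blast
      qed
    qed
  qed
qed

end
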